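(* Let $\pi\colon X\to Y$ be a continuous surjection between compact Hausdorff spaces. Then the following hold. \begin{itemize} \item[(1)] $\mathcal{M}(\pi)\colon \mathcal{M}(X)\to\mathcal{M}(Y)$ is irreducible if and only if $\pi$ is irreducible. \item[(2)] If $\pi$ is almost one-to-one, then $\mathcal{M}(\pi)\colon \mathcal{M}(X)\to\mathcal{M}(Y)$ is almost one-to-one. \item[(3)] If $\pi$ is almost one-to-one, then $\mathcal{H}(\pi)\colon \mathcal{H}(X)\to\mathcal{H}(Y)$ is almost one-to-one. \item[(4)] If moreover $X$ and $Y$ are metrizable, then $\mathcal{M}(\pi)$ is almost one-to-one if and only if $\pi$ is almost one-to-one. \end{itemize}
   Context: For a compact Hausdorff space $X$, $\mathcal{M}(X)$ denotes the set of all regular Borel probability measures on $X$, equipped with the weak*-topology (as a subset of the dual of $C(X)$, the continuous functions on $X$); it is a compact Hausdorff space. For a continuous surjection $\pi\colon X\to Y$ between compact Hausdorff spaces, $\mathcal{M}(\pi)\colon\mathcal{M}(X)\to\mathcal{M}(Y)$ is the push-forward map, $\mathcal{M}(\pi)(\mu)(f)=\mu(f\circ\pi)$ for $f\in C(Y)$, where $\mu(g)=\int g\,d\mu$; it is a continuous surjection. $\mathcal{H}(X)$ denotes the hyperspace of $X$, i.e. the set of all closed non-empty subsets of $X$, equipped with the Vietoris topology, which has as a base the sets $$\langle U_1,\dots,U_n\rangle=\Big\{A\in\mathcal{H}(X) : A\subseteq\bigcup_{i=1}^n U_i \text{ and } A\cap U_i\neq\emptyset \text{ for all } i=1,\dots,n\Big\}$$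 with $n\geq 1$ and $U_1,\dots,U_n$ open non-empty subsets of $X$; it is a compact Hausdorff space. The map $\mathcal{H}(\pi)\colon\mathcal{H}(X)\to\mathcal{H}(Y)$ is $A\mapsto\pi(A)$; it is a continuous surjection. Let $\phi\colon Z\to W$ be a continuous surjection between compact Hausdorff spaces. It is called irreducible if every closed $A\subseteq Z$ with $\phi(A)=W$ satisfies $A=Z$. A point $z\in Z$ is an injectivity point of $\phi$ if $\phi^{-1}(\phi(z))=\{z\}$. The map $\phi$ is called almost one-to-one if its set of injectivity points is dense in $Z$ (the domain). *)

theory Defs
  imports "HOL-Probability.Probability"
begin

section \<open>Regular Borel probability measures with the weak* topology\<close>

definition borel_of :: "'a topology \<Rightarrow> 'a measure" where
  "borel_of X = sigma (topspace X) {U. openin X U}"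

lemma space_borel_of [simp]: "space (borel_of X) = topspace X"
  unfolding borel_of_def by (rule space_measure_of) (auto dest: openin_subset)

lemma sets_borel_of: "sets (borel_of X) = sigma_sets (topspace X) {U. openin X U}"
  unfolding borel_of_def by (rule sets_measure_of) (auto dest: openin_subset)

lemma openin_borel_of: "openin X U \<Longrightarrow> U \<in> sets (borel_of X)"
  by (auto simp: sets_borel_of)

lemma closedin_borel_of:
  assumes "closedin X C"
  shows "C \<in> sets (borel_of X)"
proof -
  have "topspace X - (topspace X - C) \<in> sets (borel_of X)"
    using assms by (metis closedin_def openin_borel_of sets.compl_sets space_borel_of)
  then show ?thesis
    using closedin_subset[OF assms] by (simp add: double_diff)
qed

lemma measurable_borel_of:
  assumes "continuous_map X Y p"
  shows "p \<in> measurable (borel_of X) (borel_of Y)"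
proof (subst (2) borel_of_def, rule measurable_measure_of)
  show "{U. openin Y U} \<subseteq> Pow (topspace Y)"
    by (auto dest: openin_subset)
  show "p \<in> space (borel_of X) \<rightarrow> topspace Y"
    using assms by (simp add: continuous_map_def)
  fix U assume "U \<in> {U. openin Y U}"
  then have "openin X {x \<in> topspace X. p x \<in> U}"
    using assms by (simp add: continuous_map_def)
  moreover have "p -` U \<inter> space (borel_of X) = {x \<in> topspace X. p x \<in> U}"
    by auto
  ultimately show "p -` U \<inter> space (borel_of X) \<in> sets (borel_of X)"
    by (simp add: openin_borel_of)
qed

text \<open>Inner regular by compact sets and outer regular by open sets on all Borel sets. In a Hausdorff
  space compact sets are closed; \<open>closedin\<close> only keeps them measurable in general.\<close>

definition regular_measure :: "'a topology \<Rightarrow> 'a measure \<Rightarrow> bool" where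
  "regular_measure X \<mu> \<longleftrightarrow>
     (\<forall>B \<in> sets (borel_of X).
        emeasure \<mu> B = (SUP K \<in> {K. compactin X K \<and> closedin X K \<and> K \<subseteq> B}. emeasure \<mu> K) \<and>
        emeasure \<mu> B = (INF U \<in> {U. openin X U \<and> B \<subseteq> U}. emeasure \<mu> U))"

definition prob_measures :: "'a topology \<Rightarrow> 'a measure set" where
  "prob_measures X =
     {\<mu>. sets \<mu> = sets (borel_of X) \<and> prob_space \<mu> \<and> regular_measure X \<mu>}"

definition cont_funs :: "'a topology \<Rightarrow> ('a \<Rightarrow> real) set" where
  "cont_funs X = {f. continuous_map X euclideanreal f}"

text \<open>The weak* topology is the coarsest one making all evaluations
  \<open>\<mu> \<mapsto> \<integral>f d\<mu>\<close> continuous, i.e. the topology pulled back from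
  the topology of pointwise convergence on the functionals on \<open>C(X)\<close>.
  Restricting to \<open>cont_funs X\<close> by a bounded abstraction is needed because the points of a
  product topology are extensional functions.\<close>

definition measure_topology :: "'a topology \<Rightarrow> 'a measure topology" where
  "measure_topology X =
     pullback_topology (prob_measures X)
       (\<lambda>\<mu>. \<lambda>f\<in>cont_funs X. integral\<^sup>L \<mu> f)
       (product_topology (\<lambda>_. euclideanreal) (cont_funs X))"

lemma topspace_measure_topology [simp]:
  "topspace (measure_topology X) = prob_measures X"
  by (auto simp: measure_topology_def topspace_pullback_topology PiE_def)

definition push_measure :: "'b topology \<Rightarrow> ('a \<Rightarrow> 'b) \<Rightarrow> 'a measure \<Rightarrow> 'b measure" where
  "push_measure Y p \<mu> = distr \<mu> (borel_of Y) p"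

lemma integral_push_measure:
  assumes p: "continuous_map X Y p" and \<mu>: "\<mu> \<in> prob_measures X" and f: "f \<in> cont_funs Y"
  shows "integral\<^sup>L (push_measure Y p \<mu>) f = integral\<^sup>L \<mu> (f \<circ> p)"
proof -
  have s: "sets \<mu> = sets (borel_of X)"
    using \<mu> by (simp add: prob_measures_def)
  have "borel_of (euclideanreal) = borel"
    by (simp add: borel_of_def borel_def)
  then have "f \<in> borel_measurable (borel_of Y)"
    using measurable_borel_of[of Y euclideanreal f] f by (simp add: cont_funs_def)
  moreover have "p \<in> measurable \<mu> (borel_of Y)"
    using measurable_borel_of[OF p] measurable_cong_sets[OF s refl] by blast
  ultimately show ?thesis
    by (simp add: push_measure_def integral_distr o_def)
qed

lemma push_measure_in_prob_measures:
  assumes Y: "Hausdorff_space Y"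
    and p: "continuous_map X Y p" and \<mu>: "\<mu> \<in> prob_measures X"
  shows "push_measure Y p \<mu> \<in> prob_measures Y"
proof -
  interpret prob_space \<mu>
    using \<mu> by (simp add: prob_measures_def)
  have s: "sets \<mu> = sets (borel_of X)"
    using \<mu> by (simp add: prob_measures_def)
  have sp: "space \<mu> = topspace X"
    using sets_eq_imp_space_eq[OF s] by simp
  have m: "p \<in> measurable \<mu> (borel_of Y)"
    using measurable_borel_of[OF p] measurable_cong_sets[OF s refl] by blast
  let ?\<nu> = "distr \<mu> (borel_of Y) p"
  interpret N: prob_space ?\<nu>
    by (rule prob_space_distr[OF m])
  have reg: "\<exists>K. compactin Y K \<and> closedin Y K \<and> K \<subseteq> B \<and> emeasure ?\<nu> B < emeasure ?\<nu> K + e"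
    if B: "B \<in> sets (borel_of Y)" and e: "0 < e" for B and e :: ennreal
  proof -
    let ?A = "p -` B \<inter> topspace X"
    have A: "?A \<in> sets (borel_of X)"
      using measurable_sets[OF m B] s sp by simp
    have eqA: "emeasure \<mu> ?A =
        (SUP K \<in> {K. compactin X K \<and> closedin X K \<and> K \<subseteq> ?A}. emeasure \<mu> K)"
      using \<mu> A by (simp add: prob_measures_def regular_measure_def)
    have "\<exists>K. compactin X K \<and> closedin X K \<and> K \<subseteq> ?A \<and> emeasure \<mu> ?A < emeasure \<mu> K + e"
    proof (cases "emeasure \<mu> ?A = 0")
      case True
      then show ?thesis
        using e by (intro exI[of _ "{}"]) auto
    next
      case False
      then have "emeasure \<mu> ?A - e < emeasure \<mu> ?A"
        using e by (intro ennreal_between) (auto simp: zero_less_iff_neq_zero less_top[symmetric])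
      then obtain K where K: "compactin X K" "closedin X K" "K \<subseteq> ?A"
        "emeasure \<mu> ?A - e < emeasure \<mu> K"
        using less_SUP_iff[of "emeasure \<mu> ?A - e" "emeasure \<mu>"
            "{K. compactin X K \<and> closedin X K \<and> K \<subseteq> ?A}"] eqA by auto
      have "emeasure \<mu> ?A < emeasure \<mu> K + e"
      proof (rule ccontr)
        assume "\<not> emeasure \<mu> ?A < emeasure \<mu> K + e"
        then have le: "emeasure \<mu> K + e \<le> emeasure \<mu> ?A"
          by simp
        then have "e \<noteq> \<top>"
          by (auto simp: top_unique)
        then have "emeasure \<mu> K \<le> emeasure \<mu> ?A - e"
          using ennreal_minus_mono[OF le order_refl[of e]] by simp
        then show False
          using K(4) by simp
      qed
      then show ?thesis
        using K by blast
    qed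
    then obtain K where K: "compactin X K" "closedin X K" "K \<subseteq> ?A"
      "emeasure \<mu> ?A < emeasure \<mu> K + e"
      by blast
    have c: "compactin Y (p ` K)"
      using image_compactin[OF K(1) p] .
    then have cl: "closedin Y (p ` K)"
      by (rule compactin_imp_closedin[OF Y])
    have "emeasure \<mu> K \<le> emeasure \<mu> (p -` (p ` K) \<inter> space \<mu>)"
      using K(3) sp measurable_sets[OF m closedin_borel_of[OF cl]] by (intro emeasure_mono) auto
    also have "\<dots> = emeasure ?\<nu> (p ` K)"
      using emeasure_distr[OF m closedin_borel_of[OF cl]] by simp
    finally have "emeasure \<mu> K \<le> emeasure ?\<nu> (p ` K)" .
    moreover have "emeasure ?\<nu> B = emeasure \<mu> ?A"
      using emeasure_distr[OF m B] sp by simp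
    ultimately have "emeasure ?\<nu> B < emeasure ?\<nu> (p ` K) + e"
      using K(4) by (simp add: add_right_mono order.strict_trans2)
    then show ?thesis
      using c cl K(3) by (intro exI[of _ "p ` K"]) auto
  qed
  have "regular_measure Y ?\<nu>"
    unfolding regular_measure_def
  proof (intro ballI conjI)
    fix B assume B: "B \<in> sets (borel_of Y)"
    have Bt: "B \<subseteq> topspace Y"
      using sets.sets_into_space[OF B] by simp
    show "emeasure ?\<nu> B =
        (SUP K \<in> {K. compactin Y K \<and> closedin Y K \<and> K \<subseteq> B}. emeasure ?\<nu> K)" (is "_ = ?S")
    proof (rule antisym)
      show "emeasure ?\<nu> B \<le> ?S"
      proof (rule ennreal_le_epsilon)
        fix e :: real assume "0 < e"
        then obtain K where K: "compactin Y K" "closedin Y K" "K \<subseteq> B"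
          "emeasure ?\<nu> B < emeasure ?\<nu> K + ennreal e"
          using reg[OF B, of "ennreal e"] by auto
        have "emeasure ?\<nu> K \<le> ?S"
          using K by (intro SUP_upper) auto
        then show "emeasure ?\<nu> B \<le> ?S + ennreal e"
          using K(4) by (meson add_right_mono less_imp_le order_trans)
      qed
      show "?S \<le> emeasure ?\<nu> B"
        using B by (intro SUP_least emeasure_mono) auto
    qed
    show "emeasure ?\<nu> B = (INF U \<in> {U. openin Y U \<and> B \<subseteq> U}. emeasure ?\<nu> U)" (is "_ = ?I")
    proof (rule antisym)
      show "emeasure ?\<nu> B \<le> ?I"
        by (intro INF_greatest emeasure_mono) (auto simp: openin_borel_of)
      show "?I \<le> emeasure ?\<nu> B"
      proof (rule ennreal_le_epsilon)
        fix e :: real assume e: "0 < e"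
        have cB: "topspace Y - B \<in> sets (borel_of Y)"
          using B by (metis sets.compl_sets space_borel_of)
        obtain K where K: "closedin Y K" "K \<subseteq> topspace Y - B"
          "emeasure ?\<nu> (topspace Y - B) < emeasure ?\<nu> K + ennreal e"
          using reg[OF cB, of "ennreal e"] e by auto
        let ?U = "topspace Y - K"
        have U: "openin Y ?U" "B \<subseteq> ?U"
          using K Bt by auto
        have 1: "measure ?\<nu> (topspace Y - B) = 1 - measure ?\<nu> B"
          using N.prob_compl[of B] B by simp
        have 2: "measure ?\<nu> ?U = 1 - measure ?\<nu> K"
          using N.prob_compl[of K] closedin_borel_of[OF K(1)] by simp
        have "measure ?\<nu> (topspace Y - B) < measure ?\<nu> K + e"
          using K(3) e by (simp add: N.emeasure_eq_measure ennreal_less_iff flip: ennreal_plus)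
        then have "emeasure ?\<nu> ?U \<le> emeasure ?\<nu> B + ennreal e"
          using 1 2 e by (simp add: N.emeasure_eq_measure flip: ennreal_plus)
        moreover have "?I \<le> emeasure ?\<nu> ?U"
          using U by (intro INF_lower) auto
        ultimately show "?I \<le> emeasure ?\<nu> B + ennreal e"
          by (rule order_trans[rotated])
      qed
    qed
  qed
  then show ?thesis
    by (simp add: prob_measures_def push_measure_def N.prob_space_axioms)
qed


section \<open>The hyperspace with the Vietoris topology\<close>

definition hyperspace :: "'a topology \<Rightarrow> 'a set set" where
  "hyperspace X = {A. closedin X A \<and> A \<noteq> {}}"

definition vietoris_basic :: "'a topology \<Rightarrow> 'a set set \<Rightarrow> bool" where
  "vietoris_basic X \<B> \<longleftrightarrow>
     (\<exists>\<U>. finite \<U> \<and> \<U> \<noteq> {} \<and> (\<forall>U\<in>\<U>. openin X U \<and> U \<noteq> {}) \<and>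
          \<B> = {A \<in> hyperspace X. A \<subseteq> \<Union>\<U> \<and> (\<forall>U\<in>\<U>. A \<inter> U \<noteq> {})})"

definition vietoris_topology :: "'a topology \<Rightarrow> 'a set topology" where
  "vietoris_topology X = topology (arbitrary union_of vietoris_basic X)"

lemma vietoris_basic_Int:
  assumes "vietoris_basic X S" "vietoris_basic X T" "S \<inter> T \<noteq> {}"
  shows "vietoris_basic X (S \<inter> T)"
proof -
  obtain \<U> where U: "finite \<U>" "\<U> \<noteq> {}" "\<forall>U\<in>\<U>. openin X U \<and> U \<noteq> {}"
    "S = {A \<in> hyperspace X. A \<subseteq> \<Union>\<U> \<and> (\<forall>U\<in>\<U>. A \<inter> U \<noteq> {})}"
    using assms(1) by (auto simp: vietoris_basic_def)
  obtain \<V> where V: "finite \<V>" "\<V> \<noteq> {}" "\<forall>U\<in>\<V>. openin X U \<and> U \<noteq> {}"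
    "T = {A \<in> hyperspace X. A \<subseteq> \<Union>\<V> \<and> (\<forall>U\<in>\<V>. A \<inter> U \<noteq> {})}"
    using assms(2) by (auto simp: vietoris_basic_def)
  define \<W> where "\<W> = (\<lambda>U. U \<inter> \<Union>\<V>) ` \<U> \<union> (\<lambda>V. V \<inter> \<Union>\<U>) ` \<V>"
  have UnW: "\<Union>\<W> = \<Union>\<U> \<inter> \<Union>\<V>"
    using U(2) V(2) by (auto simp: \<W>_def)
  have eq: "S \<inter> T = {A \<in> hyperspace X. A \<subseteq> \<Union>\<W> \<and> (\<forall>W\<in>\<W>. A \<inter> W \<noteq> {})}" (is "_ = ?R")
  proof (intro equalityI subsetI)
    fix A assume A: "A \<in> S \<inter> T"
    then have *: "A \<in> hyperspace X" "A \<subseteq> \<Union>\<U>" "A \<subseteq> \<Union>\<V>"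
      "\<forall>U\<in>\<U>. A \<inter> U \<noteq> {}" "\<forall>U\<in>\<V>. A \<inter> U \<noteq> {}"
      using U(4) V(4) by auto
    have "A \<subseteq> \<Union>\<W>"
      using *(2,3) UnW by simp
    moreover have "\<forall>W\<in>\<W>. A \<inter> W \<noteq> {}"
    proof
      fix W assume "W \<in> \<W>"
      then consider U where "U \<in> \<U>" "W = U \<inter> \<Union>\<V>" | V where "V \<in> \<V>" "W = V \<inter> \<Union>\<U>"
        unfolding \<W>_def by blast
      then show "A \<inter> W \<noteq> {}"
      proof cases
        case 1
        then have "A \<inter> W = A \<inter> U"
          using *(3) by blast
        then show ?thesis
          using *(4) 1(1) by simp
      next
        case 2
        then have "A \<inter> W = A \<inter> V"
          using *(2) by blast
        then show ?thesis
          using *(5) 2(1) by simp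
      qed
    qed
    ultimately show "A \<in> ?R"
      using *(1) by blast
  next
    fix A assume "A \<in> ?R"
    then have *: "A \<in> hyperspace X" "A \<subseteq> \<Union>\<W>" "\<forall>W\<in>\<W>. A \<inter> W \<noteq> {}"
      by auto
    have "A \<subseteq> \<Union>\<U>" "A \<subseteq> \<Union>\<V>"
      using *(2) UnW by simp_all
    moreover have "\<forall>U\<in>\<U>. A \<inter> U \<noteq> {}"
    proof
      fix U assume "U \<in> \<U>"
      then have "U \<inter> \<Union>\<V> \<in> \<W>"
        by (simp add: \<W>_def)
      then show "A \<inter> U \<noteq> {}"
        using *(3) by fast
    qed
    moreover have "\<forall>V\<in>\<V>. A \<inter> V \<noteq> {}"
    proof
      fix V assume "V \<in> \<V>"
      then have "V \<inter> \<Union>\<U> \<in> \<W>"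
        by (simp add: \<W>_def)
      then show "A \<inter> V \<noteq> {}"
        using *(3) by fast
    qed
    ultimately show "A \<in> S \<inter> T"
      using *(1) unfolding U(4) V(4) by simp
  qed
  have "finite \<W>" "\<W> \<noteq> {}"
    using U V by (auto simp: \<W>_def)
  moreover have "\<forall>W\<in>\<W>. openin X W"
    using U(3) V(3) by (auto simp: \<W>_def)
  moreover have "\<forall>W\<in>\<W>. W \<noteq> {}"
    using eq assms(3) by blast
  ultimately show ?thesis
    unfolding vietoris_basic_def using eq by blast
qed

lemma openin_vietoris_topology:
  "openin (vietoris_topology X) = arbitrary union_of vietoris_basic X"
proof -
  have "istopology (arbitrary union_of vietoris_basic X)"
    unfolding istopology_base_eq
  proof (intro allI impI)
    fix S T assume "vietoris_basic X S \<and> vietoris_basic X T"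
    then show "(arbitrary union_of vietoris_basic X) (S \<inter> T)"
      using vietoris_basic_Int[of X S T]
      by (cases "S \<inter> T = {}") (auto simp: arbitrary_union_of_empty arbitrary_union_of_inc)
  qed
  then show ?thesis
    by (simp add: vietoris_topology_def topology_inverse')
qed

lemma topspace_vietoris_topology [simp]:
  "topspace (vietoris_topology X) = hyperspace X"
proof (intro equalityI subsetI)
  fix A assume "A \<in> topspace (vietoris_topology X)"
  then obtain \<B> where "vietoris_basic X \<B>" "A \<in> \<B>"
    by (auto simp: topspace_def openin_vietoris_topology union_of_def)
  then show "A \<in> hyperspace X"
    by (auto simp: vietoris_basic_def)
next
  fix A assume A: "A \<in> hyperspace X"
  then have sub: "A \<subseteq> topspace X" "A \<noteq> {}"
    by (auto simp: hyperspace_def dest: closedin_subset)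
  let ?B = "{A \<in> hyperspace X. A \<subseteq> \<Union>{topspace X} \<and> (\<forall>U\<in>{topspace X}. A \<inter> U \<noteq> {})}"
  have "vietoris_basic X ?B"
    unfolding vietoris_basic_def using sub by (intro exI[of _ "{topspace X}"]) auto
  then have "openin (vietoris_topology X) ?B"
    by (simp add: openin_vietoris_topology arbitrary_union_of_inc)
  moreover have "A \<in> ?B"
    using A sub by auto
  ultimately show "A \<in> topspace (vietoris_topology X)"
    using openin_subset by blast
qed


section \<open>Irreducible and almost one-to-one maps\<close>

definition continuous_surjection :: "'a topology \<Rightarrow> 'b topology \<Rightarrow> ('a \<Rightarrow> 'b) \<Rightarrow> bool" where
  "continuous_surjection Z W p \<longleftrightarrow> continuous_map Z W p \<and> p ` topspace Z = topspace W"

definition irreducible_map :: "'a topology \<Rightarrow> 'b topology \<Rightarrow> ('a \<Rightarrow> 'b) \<Rightarrow> bool" where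
  "irreducible_map Z W p \<longleftrightarrow>
     continuous_surjection Z W p \<and>
     (\<forall>A. closedin Z A \<and> p ` A = topspace W \<longrightarrow> A = topspace Z)"

definition injectivity_points :: "'a topology \<Rightarrow> ('a \<Rightarrow> 'b) \<Rightarrow> 'a set" where
  "injectivity_points Z p =
     {z \<in> topspace Z. {x \<in> topspace Z. p x = p z} = {z}}"

definition almost_one_to_one :: "'a topology \<Rightarrow> 'b topology \<Rightarrow> ('a \<Rightarrow> 'b) \<Rightarrow> bool" where
  "almost_one_to_one Z W p \<longleftrightarrow>
     continuous_surjection Z W p \<and>
     Z closure_of (injectivity_points Z p) = topspace Z"

end

theory Submission
  imports Defs
begin

text \<open>
  Two facts carry everything.

  The first is that every measure lifts: if \<open>A \<subseteq> X\<close> is closed and \<open>p ` A = Y\<close>,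
  then each regular measure \<open>\<nu>\<close> on \<open>Y\<close> is the push-forward of a regular measure on \<open>X\<close>
  that is concentrated on \<open>A\<close> (\<open>measure_lift\<close>). A finite family of Borel sets cuts \<open>Y\<close> into
  finitely many cells, and placing the mass of each cell on a single point of \<open>A\<close> above it gives a set function
  with the right values on the preimages of the family. By Tychonoff's theorem these fit together into one finitely
  additive set function \<open>lam\<close> on all subsets of \<open>X\<close> with \<open>lam (p -` B) = \<nu> B\<close> for every Borel
  \<open>B\<close>. Finite additivity is then repaired: the values \<open>inf {lam U | U \<supseteq> K open}\<close> on closed sets
  \<open>K\<close> belong to a regular Borel measure, by Caratheodory's construction, and the regularity of \<open>\<nu>\<close>
  shows that passing to the infimum does not change the push-forward.

  The second is an approximation (\<open>fibre_approximation\<close>). Suppose that every non-empty open set of \<open>X\<close>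
  contains a whole fibre of \<open>p\<close> through a point of a set \<open>S\<close>. Cover \<open>X\<close> by finitely many open
  sets on which given continuous functions are almost constant, and move the mass of \<open>\<mu>\<close> in each of them to a
  point of \<open>S\<close> whose fibre lies in it. The resulting \<open>\<mu>0\<close> lives on a finite subset of \<open>S\<close>,
  and \<^emph>\<open>every\<close> measure with the same push-forward as \<open>\<mu>0\<close> is weak* close to
  \<open>\<mu>\<close>, since it can only redistribute mass within those finitely many small fibres.

  If \<open>p\<close> is irreducible, then non-empty open sets contain whole fibres, so \<open>S = X\<close> is allowed. A
  closed set of measures that is mapped onto all measures on \<open>Y\<close> contains some measure with the push-forward of
  \<open>\<mu>0\<close>, hence is dense; so the push-forward map is irreducible. Conversely, if a proper closed \<open>A\<close> satisfies \<open>p ` A = Y\<close>, then the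
  measures concentrated on \<open>A\<close> form a closed set that is mapped onto all measures on \<open>Y\<close> by the
  lifting theorem, but that misses the point masses outside \<open>A\<close>.

  If \<open>p\<close> is almost one-to-one, take for \<open>S\<close> its injectivity points: a measure on finitely many injectivity points is
  determined by its push-forward, so the measures \<open>\<mu>0\<close> are injectivity points of the
  push-forward map. In the hyperspace, finite sets of injectivity points play the same role. For the converse in the
  metrizable case, almost one-to-one maps are irreducible, so if the push-forward map is almost one-to-one, then
  \<open>p\<close> is irreducible. That \<open>p\<close> is then almost one-to-one is a statement about \<open>p\<close> alone; on a compact metrizable space it
  follows from Baire's theorem, since the points with a fibre of diameter less than \<open>1/n\<close> contain a dense open
  set.
\<close>

section \<open>Regular measures on compact Hausdorff spaces\<close>

lemma sets_prob_measures: "\<mu> \<in> prob_measures X \<Longrightarrow> sets \<mu> = sets (borel_of X)"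
  by (simp add: prob_measures_def)

lemma space_prob_measures: "\<mu> \<in> prob_measures X \<Longrightarrow> space \<mu> = topspace X"
  using sets_eq_imp_space_eq[OF sets_prob_measures, of \<mu> X] by simp

lemma prob_space_prob_measures: "\<mu> \<in> prob_measures X \<Longrightarrow> prob_space \<mu>"
  by (simp add: prob_measures_def)

lemma measurable_prob_measures:
  assumes "\<mu> \<in> prob_measures X" "continuous_map X Y p"
  shows "p \<in> measurable \<mu> (borel_of Y)"
  using measurable_borel_of[OF assms(2)] measurable_cong_sets[OF sets_prob_measures[OF assms(1)] refl] by blast

lemma emeasure_push_measure:
  assumes "\<mu> \<in> prob_measures X" "continuous_map X Y p" "B \<in> sets (borel_of Y)"
  shows "emeasure (push_measure Y p \<mu>) B = emeasure \<mu> (p -` B \<inter> topspace X)"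
  using emeasure_distr[OF measurable_prob_measures[OF assms(1,2)] assms(3)] space_prob_measures[OF assms(1)]
  by (simp add: push_measure_def)

text \<open>For a finite measure on a compact space, approximation from outside suffices: the complements of
  open sets containing the complement of \<open>B\<close> are compact subsets of \<open>B\<close>.\<close>

lemma regular_measureI_outer:
  assumes X: "compact_space X"
    and s: "sets \<mu> = sets (borel_of X)" and prob: "prob_space \<mu>"
    and outer: "\<And>B e. B \<in> sets (borel_of X) \<Longrightarrow> 0 < (e::real) \<Longrightarrow>
      \<exists>U. openin X U \<and> B \<subseteq> U \<and> measure \<mu> U \<le> measure \<mu> B + e"
  shows "regular_measure X \<mu>"
  unfolding regular_measure_def
proof (intro ballI conjI)
  interpret prob_space \<mu> by (rule prob)
  have sp: "space \<mu> = topspace X"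
    using sets_eq_imp_space_eq[OF s] by simp
  fix B assume B: "B \<in> sets (borel_of X)"
  have Bt: "B \<subseteq> topspace X"
    using sets.sets_into_space[OF B] by simp
  show "emeasure \<mu> B = (SUP K \<in> {K. compactin X K \<and> closedin X K \<and> K \<subseteq> B}. emeasure \<mu> K)" (is "_ = ?S")
  proof (rule antisym)
    show "?S \<le> emeasure \<mu> B"
      using B s by (intro SUP_least emeasure_mono) auto
    show "emeasure \<mu> B \<le> ?S"
    proof (rule ennreal_le_epsilon)
      fix e :: real assume e: "0 < e"
      have cB: "topspace X - B \<in> sets (borel_of X)"
        using B by (metis sets.compl_sets space_borel_of)
      obtain U where U: "openin X U" "topspace X - B \<subseteq> U"
        "measure \<mu> U \<le> measure \<mu> (topspace X - B) + e"
        using outer[OF cB e] by blast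
      let ?K = "topspace X - U"
      have K: "closedin X ?K" "?K \<subseteq> B"
        using U(1) closedin_def U(2) by auto
      have 1: "measure \<mu> (topspace X - B) = 1 - measure \<mu> B"
        using prob_compl[of B] B s sp by simp
      have 2: "measure \<mu> ?K = 1 - measure \<mu> U"
        using prob_compl[of U] openin_borel_of[OF U(1)] s sp by simp
      have "emeasure \<mu> B \<le> emeasure \<mu> ?K + ennreal e"
        using U(3) 1 2 e by (simp add: emeasure_eq_measure flip: ennreal_plus)
      also have "emeasure \<mu> ?K \<le> ?S"
        using K closedin_compact_space[OF X] by (intro SUP_upper) auto
      finally show "emeasure \<mu> B \<le> ?S + ennreal e"
        by (simp add: add_right_mono)
    qed
  qed
  show "emeasure \<mu> B = (INF U \<in> {U. openin X U \<and> B \<subseteq> U}. emeasure \<mu> U)" (is "_ = ?I")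
  proof (rule antisym)
    show "emeasure \<mu> B \<le> ?I"
      using s by (intro INF_greatest emeasure_mono) (auto simp: openin_borel_of)
    show "?I \<le> emeasure \<mu> B"
    proof (rule ennreal_le_epsilon)
      fix e :: real assume e: "0 < e"
      obtain U where U: "openin X U" "B \<subseteq> U" "measure \<mu> U \<le> measure \<mu> B + e"
        using outer[OF B e] by blast
      have "?I \<le> emeasure \<mu> U"
        using U by (intro INF_lower) auto
      also have "\<dots> \<le> emeasure \<mu> B + ennreal e"
        using U(3) e by (simp add: emeasure_eq_measure flip: ennreal_plus)
      finally show "?I \<le> emeasure \<mu> B + ennreal e" .
    qed
  qed
qed

lemma prob_measures_eqI:
  assumes \<mu>: "\<mu> \<in> prob_measures X" and \<mu>': "\<mu>' \<in> prob_measures X"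
    and eq: "\<And>K. closedin X K \<Longrightarrow> emeasure \<mu> K = emeasure \<mu>' K"
  shows "\<mu> = \<mu>'"
proof (rule measure_eqI)
  show s: "sets \<mu> = sets \<mu>'"
    using \<mu> \<mu>' by (simp add: prob_measures_def)
  fix B assume "B \<in> sets \<mu>"
  then have B: "B \<in> sets (borel_of X)"
    using \<mu> by (simp add: prob_measures_def)
  have "emeasure \<mu> B = (SUP K \<in> {K. compactin X K \<and> closedin X K \<and> K \<subseteq> B}. emeasure \<mu> K)"
    using \<mu> B by (simp add: prob_measures_def regular_measure_def)
  also have "\<dots> = (SUP K \<in> {K. compactin X K \<and> closedin X K \<and> K \<subseteq> B}. emeasure \<mu>' K)"
    using eq by (intro SUP_cong) auto
  also have "\<dots> = emeasure \<mu>' B"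
    using \<mu>' B by (simp add: prob_measures_def regular_measure_def)
  finally show "emeasure \<mu> B = emeasure \<mu>' B" .
qed

text \<open>If \<open>S\<close> is finite and carries all mass, then removing from the space the points of
  \<open>S\<close> outside \<open>B\<close> leaves an open superset of \<open>B\<close> of the same
  measure.\<close>

lemma finitely_supported_in_prob_measures:
  assumes X: "compact_space X" "Hausdorff_space X" and s: "sets \<mu> = sets (borel_of X)"
    and prob: "prob_space \<mu>" and S: "finite S" "S \<subseteq> topspace X" "emeasure \<mu> S = 1"
  shows "\<mu> \<in> prob_measures X"
proof -
  interpret prob_space \<mu> by (rule prob)
  have fin: "T \<in> sets \<mu>" "closedin X T" if "T \<subseteq> S" for T
  proof -
    show "closedin X T"
      using that S X closedin_Hausdorff_finite by (metis finite_subset subset_trans)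
    then show "T \<in> sets \<mu>"
      using closedin_borel_of s by blast
  qed
  have "\<exists>U. openin X U \<and> B \<subseteq> U \<and> measure \<mu> U \<le> measure \<mu> B + e"
    if B: "B \<in> sets (borel_of X)" and e: "0 < e" for B and e :: real
  proof (intro exI conjI)
    let ?U = "topspace X - (S - B)"
    show "openin X ?U"
      using fin(2)[of "S - B"] by auto
    show "B \<subseteq> ?U"
      using sets.sets_into_space[OF B] by auto
    have AE: "AE x in \<mu>. x \<in> S"
      using S(3) fin(1)[of S] by (simp add: emeasure_eq_measure AE_in_set_eq_1)
    have "measure \<mu> ?U \<le> measure \<mu> B"
      using AE B s by (intro finite_measure_mono_AE) (auto elim!: eventually_mono)
    then show "measure \<mu> ?U \<le> measure \<mu> B + e"
      using e by simp
  qed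
  then have "regular_measure X \<mu>"
    using X s prob by (intro regular_measureI_outer) auto
  then show ?thesis
    using s prob by (simp add: prob_measures_def)
qed

section \<open>The regular measure induced by a finitely additive set function\<close>

text \<open>The construction follows the proof of the Riesz representation theorem, with the values \<open>lam
  U\<close> of a finitely additive set function on open sets in place of the values of a functional. Each of
  the three set functions below corrects one defect: \<open>content\<close> makes the values on closed sets
  continuous from outside, \<open>open_content\<close> makes the values on open sets inner regular and thereby
  countably subadditive, and \<open>outer\<close> extends them to an outer measure.\<close>

locale additive_set_function =
  fixes X :: "'a topology" and lam :: "'a set \<Rightarrow> ennreal"
  assumes compact: "compact_space X" and Hausdorff: "Hausdorff_space X"
    and lam_empty: "lam {} = 0"
    and lam_Un: "\<And>E F. E \<subseteq> topspace X \<Longrightarrow> F \<subseteq> topspace X \<Longrightarrow> E \<inter> F = {} \<Longrightarrow> lam (E \<union> F) = lam E + lam F"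
    and lam_total: "lam (topspace X) = 1"
begin

definition content :: "'a set \<Rightarrow> ennreal" where
  "content K = (INF U \<in> {U. openin X U \<and> K \<subseteq> U}. lam U)"

definition open_content :: "'a set \<Rightarrow> ennreal" where
  "open_content U = (SUP K \<in> {K. closedin X K \<and> K \<subseteq> U}. content K)"

definition outer :: "'a set \<Rightarrow> ennreal" where
  "outer E = (INF U \<in> {U. openin X U \<and> E \<subseteq> U}. open_content U)"

lemma normal: "normal_space X"
  using compact Hausdorff by (simp add: compact_Hausdorff_or_regular_imp_normal_space)

lemma lam_mono:
  assumes "E \<subseteq> F" "F \<subseteq> topspace X"
  shows "lam E \<le> lam F"
proof -
  have "lam F = lam E + lam (F - E)"
    using lam_Un[of E "F - E"] assms by (simp add: Un_absorb1 subset_trans Diff_subset[THEN subset_trans])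
  then show ?thesis by simp
qed

lemma lam_Un_le:
  assumes "E \<subseteq> topspace X" "F \<subseteq> topspace X"
  shows "lam (E \<union> F) \<le> lam E + lam F"
proof -
  have "lam (E \<union> F) = lam E + lam (F - E)"
    using lam_Un[of E "F - E"] assms by (simp add: Diff_subset[THEN subset_trans])
  also have "\<dots> \<le> lam E + lam F"
    using assms by (intro add_left_mono lam_mono) auto
  finally show ?thesis .
qed

lemma content_le_lam: "openin X U \<Longrightarrow> K \<subseteq> U \<Longrightarrow> content K \<le> lam U"
  unfolding content_def by (rule INF_lower) simp

lemma content_greatest: "(\<And>U. openin X U \<Longrightarrow> K \<subseteq> U \<Longrightarrow> c \<le> lam U) \<Longrightarrow> c \<le> content K"
  unfolding content_def by (rule INF_greatest) simp

lemma content_finite: "K \<subseteq> topspace X \<Longrightarrow> content K \<noteq> \<top>"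
  using content_le_lam[of "topspace X" K] lam_total by (auto simp: top_unique)

lemma content_approx:
  assumes "K \<subseteq> topspace X" "0 < (e::real)"
  obtains U where "openin X U" "K \<subseteq> U" "lam U \<le> content K + ennreal e"
proof -
  have "\<exists>U\<in>{U. openin X U \<and> K \<subseteq> U}. lam U < content K + ennreal e"
    using content_finite[OF assms(1)] by (intro INF_approx_ennreal assms content_def) auto
  then show thesis using that by (auto simp: less_imp_le)
qed

lemma content_Un_le:
  assumes "K \<subseteq> topspace X" "L \<subseteq> topspace X"
  shows "content (K \<union> L) \<le> content K + content L"
proof (rule ennreal_le_epsilon)
  fix e :: real assume e: "0 < e"
  obtain U where U: "openin X U" "K \<subseteq> U" "lam U \<le> content K + ennreal (e/2)"
    using content_approx[OF assms(1), of "e/2"] e by auto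
  obtain V where V: "openin X V" "L \<subseteq> V" "lam V \<le> content L + ennreal (e/2)"
    using content_approx[OF assms(2), of "e/2"] e by auto
  have "content (K \<union> L) \<le> lam (U \<union> V)"
    using U V by (intro content_le_lam) auto
  also have "\<dots> \<le> lam U + lam V"
    using U V by (intro lam_Un_le openin_subset)
  also have "\<dots> \<le> (content K + ennreal (e/2)) + (content L + ennreal (e/2))"
    using U V by (intro add_mono)
  also have "\<dots> = content K + content L + (ennreal (e/2) + ennreal (e/2))"
    by (simp add: ac_simps)
  also have "ennreal (e/2) + ennreal (e/2) = ennreal e"
    using e by (simp flip: ennreal_plus)
  finally show "content (K \<union> L) \<le> content K + content L + ennreal e" .
qed

text \<open>Disjoint closed sets have disjoint open neighbourhoods, on which \<open>lam\<close> is
  additive.\<close>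

lemma content_disjoint_Un:
  assumes K: "closedin X K" and L: "closedin X L" and d: "K \<inter> L = {}"
  shows "content K + content L \<le> content (K \<union> L)"
proof (rule content_greatest)
  fix W assume W: "openin X W" "K \<union> L \<subseteq> W"
  obtain U V where UV: "openin X U" "openin X V" "K \<subseteq> U" "L \<subseteq> V" "disjnt U V"
    using normal K L d unfolding normal_space_def disjnt_def by metis
  have "content K + content L \<le> lam (W \<inter> U) + lam (W \<inter> V)"
    using UV W by (intro add_mono content_le_lam) auto
  also have "\<dots> = lam ((W \<inter> U) \<union> (W \<inter> V))"
    using UV W openin_subset[OF W(1)] by (intro lam_Un[symmetric]) (auto simp: disjnt_def)
  also have "\<dots> \<le> lam W"
    using openin_subset[OF W(1)] by (intro lam_mono) auto
  finally show "content K + content L \<le> lam W" .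
qed

lemma content_le_open_content: "closedin X K \<Longrightarrow> K \<subseteq> U \<Longrightarrow> content K \<le> open_content U"
  unfolding open_content_def by (rule SUP_upper) simp

lemma open_content_least:
  "(\<And>K. closedin X K \<Longrightarrow> K \<subseteq> U \<Longrightarrow> content K \<le> c) \<Longrightarrow> open_content U \<le> c"
  unfolding open_content_def by (rule SUP_least) simp

lemma open_content_mono: "U \<subseteq> V \<Longrightarrow> open_content U \<le> open_content V"
  by (intro open_content_least content_le_open_content) auto

lemma open_content_le_lam: "openin X U \<Longrightarrow> open_content U \<le> lam U"
  by (intro open_content_least content_le_lam)

lemma closed_subset_Un_split:
  assumes K: "closedin X K" and U: "openin X U" and V: "openin X V" and sub: "K \<subseteq> U \<union> V"
  obtains K1 K2 where "closedin X K1" "closedin X K2" "K1 \<subseteq> U" "K2 \<subseteq> V" "K = K1 \<union> K2"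
proof -
  have "closedin X (K - U)" "closedin X (K - V)" "disjnt (K - U) (K - V)"
    using K U V sub by (auto simp: closedin_diff disjnt_def)
  then obtain P Q where PQ: "openin X P" "openin X Q" "K - U \<subseteq> P" "K - V \<subseteq> Q" "disjnt P Q"
    using normal unfolding normal_space_def by metis
  show thesis
    by (rule that[of "K - P" "K - Q"]) (use K PQ in \<open>auto simp: closedin_diff disjnt_def\<close>)
qed

lemma open_content_Un_le:
  assumes U: "openin X U" and V: "openin X V"
  shows "open_content (U \<union> V) \<le> open_content U + open_content V"
proof (rule open_content_least)
  fix K assume "closedin X K" "K \<subseteq> U \<union> V"
  then obtain K1 K2 where K: "closedin X K1" "closedin X K2" "K1 \<subseteq> U" "K2 \<subseteq> V" "K = K1 \<union> K2"
    using closed_subset_Un_split[OF _ U V] by metis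
  have "content K \<le> content K1 + content K2"
    unfolding K(5) using K by (intro content_Un_le closedin_subset)
  also have "\<dots> \<le> open_content U + open_content V"
    using K by (intro add_mono content_le_open_content)
  finally show "content K \<le> open_content U + open_content V" .
qed

lemma open_content_empty: "open_content {} = 0"
  using open_content_le_lam[of "{}"] lam_empty by simp

lemma open_content_UN_finite_le:
  assumes "\<And>i. openin X (U i)"
  shows "open_content (\<Union>i<n::nat. U i) \<le> (\<Sum>i<n. open_content (U i))"
proof (induction n)
  case 0
  show ?case by (simp add: open_content_empty)
next
  case (Suc n)
  have "open_content (\<Union>i<Suc n. U i) = open_content ((\<Union>i<n. U i) \<union> U n)"
    by (simp add: lessThan_Suc Un_commute)
  also have "\<dots> \<le> open_content (\<Union>i<n. U i) + open_content (U n)"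
    using assms by (intro open_content_Un_le) auto
  also have "\<dots> \<le> (\<Sum>i<Suc n. open_content (U i))"
    using Suc by (simp add: add_right_mono)
  finally show ?case .
qed

text \<open>This is where compactness turns finite into countable subadditivity: a closed subset of a
  countable union lies in a finite union.\<close>

lemma open_content_UN_le:
  assumes U: "\<And>i. openin X (U i)"
  shows "open_content (\<Union>i::nat. U i) \<le> (\<Sum>i. open_content (U i))"
proof (rule open_content_least)
  fix K assume K: "closedin X K" "K \<subseteq> (\<Union>i. U i)"
  have "compactin X K"
    using K compact by (simp add: closedin_compact_space)
  then obtain \<F> where F: "finite \<F>" "\<F> \<subseteq> range U" "K \<subseteq> \<Union>\<F>"
    using K(2) U unfolding compactin_def by (metis (no_types, lifting) image_iff)
  then obtain I where I: "finite I" "\<F> = U ` I"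
    by (metis finite_subset_image)
  then obtain n where n: "I \<subseteq> {..<n}"
    by (meson finite_nat_iff_bounded)
  have "K \<subseteq> (\<Union>i<n. U i)"
    using F(3) n unfolding I(2) by blast
  then have "content K \<le> open_content (\<Union>i<n. U i)"
    using K by (intro content_le_open_content)
  also have "\<dots> \<le> (\<Sum>i<n. open_content (U i))"
    by (rule open_content_UN_finite_le[OF U])
  also have "\<dots> \<le> (\<Sum>i. open_content (U i))"
    by (intro sum_le_suminf) auto
  finally show "content K \<le> (\<Sum>i. open_content (U i))" .
qed

lemma outer_le_open_content: "openin X U \<Longrightarrow> E \<subseteq> U \<Longrightarrow> outer E \<le> open_content U"
  unfolding outer_def by (rule INF_lower) simp

lemma outer_greatest: "(\<And>U. openin X U \<Longrightarrow> E \<subseteq> U \<Longrightarrow> c \<le> open_content U) \<Longrightarrow> c \<le> outer E"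
  unfolding outer_def by (rule INF_greatest) simp

lemma outer_mono: "E \<subseteq> F \<Longrightarrow> outer E \<le> outer F"
  by (intro outer_greatest outer_le_open_content) auto

lemma outer_open: "openin X U \<Longrightarrow> outer U = open_content U"
  by (intro antisym outer_le_open_content outer_greatest open_content_mono) auto

text \<open>On closed sets nothing is lost in the passage through \<open>open_content\<close>, because
  \<open>content K \<le> open_content U \<le> lam U\<close> whenever \<open>K \<subseteq> U\<close>.\<close>

lemma outer_closed:
  assumes "closedin X K"
  shows "outer K = content K"
proof (rule antisym)
  show "outer K \<le> content K"
    by (rule content_greatest) (meson order_trans outer_le_open_content open_content_le_lam)
  show "content K \<le> outer K"
    using assms by (intro outer_greatest content_le_open_content)
qed

lemma outer_finite: "E \<subseteq> topspace X \<Longrightarrow> outer E \<noteq> \<top>"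
  using outer_le_open_content[of "topspace X" E] open_content_le_lam[of "topspace X"] lam_total
  by (auto simp: top_unique)

lemma outer_approx:
  assumes "E \<subseteq> topspace X" "0 < (e::real)"
  obtains U where "openin X U" "E \<subseteq> U" "open_content U \<le> outer E + ennreal e"
proof -
  have "\<exists>U\<in>{U. openin X U \<and> E \<subseteq> U}. open_content U < outer E + ennreal e"
    using outer_finite[OF assms(1)] by (intro INF_approx_ennreal assms outer_def) auto
  then show thesis using that by (auto simp: less_imp_le)
qed

lemma outer_UN_le:
  assumes E: "\<And>i. E i \<subseteq> topspace X"
  shows "outer (\<Union>i::nat. E i) \<le> (\<Sum>i. outer (E i))"
proof (rule ennreal_le_epsilon)
  fix e :: real assume e: "0 < e"
  have "\<exists>U. openin X U \<and> E i \<subseteq> U \<and> open_content U \<le> outer (E i) + ennreal (e * (1/2)^Suc i)" for i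
    using outer_approx[OF E[of i], of "e * (1/2)^Suc i"] e by (metis mult_pos_pos zero_less_power half_gt_zero_iff zero_less_one)
  then obtain U where U: "\<And>i. openin X (U i)" "\<And>i. E i \<subseteq> U i"
    "\<And>i. open_content (U i) \<le> outer (E i) + ennreal (e * (1/2)^Suc i)"
    by metis
  have "outer (\<Union>i. E i) \<le> open_content (\<Union>i. U i)"
    using U by (intro outer_le_open_content) auto
  also have "\<dots> \<le> (\<Sum>i. open_content (U i))"
    by (rule open_content_UN_le[OF U(1)])
  also have "\<dots> \<le> (\<Sum>i. outer (E i) + ennreal (e * (1/2)^Suc i))"
    by (intro suminf_le U(3)) auto
  also have "\<dots> = (\<Sum>i. outer (E i)) + (\<Sum>i. ennreal (e * (1/2)^Suc i))"
    by (intro suminf_add[symmetric]) auto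
  also have "(\<Sum>i. ennreal (e * (1/2)^Suc i)) = ennreal e"
  proof -
    have "(\<lambda>i. e * (1/2)^Suc i) sums (e * 1)"
      by (intro sums_mult power_half_series)
    then show ?thesis
      using e by (intro suminf_ennreal_eq) auto
  qed
  finally show "outer (\<Union>i. E i) \<le> (\<Sum>i. outer (E i)) + ennreal e" .
qed

lemma outer_Un_le:
  assumes "E \<subseteq> topspace X" "F \<subseteq> topspace X"
  shows "outer (E \<union> F) \<le> outer E + outer F"
proof (rule ennreal_le_epsilon)
  fix e :: real assume e: "0 < e"
  obtain U where U: "openin X U" "E \<subseteq> U" "open_content U \<le> outer E + ennreal (e/2)"
    using outer_approx[OF assms(1), of "e/2"] e by auto
  obtain V where V: "openin X V" "F \<subseteq> V" "open_content V \<le> outer F + ennreal (e/2)"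
    using outer_approx[OF assms(2), of "e/2"] e by auto
  have "outer (E \<union> F) \<le> open_content (U \<union> V)"
    using U V by (intro outer_le_open_content) auto
  also have "\<dots> \<le> open_content U + open_content V"
    using U V by (intro open_content_Un_le)
  also have "\<dots> \<le> (outer E + ennreal (e/2)) + (outer F + ennreal (e/2))"
    using U V by (intro add_mono)
  also have "\<dots> = outer E + outer F + (ennreal (e/2) + ennreal (e/2))"
    by (simp add: ac_simps)
  also have "ennreal (e/2) + ennreal (e/2) = ennreal e"
    using e by (simp flip: ennreal_plus)
  finally show "outer (E \<union> F) \<le> outer E + outer F + ennreal e" .
qed

text \<open>Exhaust \<open>U \<inter> V\<close> by a closed set \<open>K\<close> and then the open set
  \<open>V - K\<close>, which contains \<open>V - U\<close>, by a closed set \<open>L\<close>; the contents of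
  the disjoint sets \<open>K\<close> and \<open>L\<close> add up.\<close>

lemma open_content_split:
  assumes U: "openin X U" and V: "openin X V"
  shows "open_content (U \<inter> V) + outer (V - U) \<le> open_content V"
proof -
  have le: "content K + outer (V - U) \<le> open_content V" if K: "closedin X K" "K \<subseteq> U \<inter> V" for K
  proof -
    have "outer (V - U) \<le> open_content (V - K)"
      using K V by (intro outer_le_open_content) auto
    then have "content K + outer (V - U) \<le> content K + open_content (V - K)"
      by (rule add_left_mono)
    also have "\<dots> = (SUP L \<in> {L. closedin X L \<and> L \<subseteq> V - K}. content K + content L)"
      unfolding open_content_def by (rule ennreal_SUP_add_right) (use closedin_empty in blast)
    also have "\<dots> \<le> open_content V"
    proof (rule SUP_least)
      fix L assume L: "L \<in> {L. closedin X L \<and> L \<subseteq> V - K}"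
      have "content K + content L \<le> content (K \<union> L)"
        using K L by (intro content_disjoint_Un) auto
      also have "\<dots> \<le> open_content V"
        using K L by (intro content_le_open_content) auto
      finally show "content K + content L \<le> open_content V" .
    qed
    finally show ?thesis .
  qed
  have "open_content (U \<inter> V) + outer (V - U)
      = (SUP K \<in> {K. closedin X K \<and> K \<subseteq> U \<inter> V}. content K + outer (V - U))"
    unfolding open_content_def by (rule ennreal_SUP_add_left[symmetric]) (use closedin_empty in blast)
  also have "\<dots> \<le> open_content V"
    using le by (intro SUP_least) auto
  finally show ?thesis .
qed

lemma open_in_lambda_system:
  assumes U: "openin X U"
  shows "U \<in> lambda_system (topspace X) (Pow (topspace X)) outer"
proof -
  have "outer (U \<inter> E) + outer ((topspace X - U) \<inter> E) = outer E" if E: "E \<subseteq> topspace X" for E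
  proof (rule antisym)
    show "outer (U \<inter> E) + outer ((topspace X - U) \<inter> E) \<le> outer E"
    proof (rule outer_greatest)
      fix V assume V: "openin X V" "E \<subseteq> V"
      have "outer (U \<inter> E) + outer ((topspace X - U) \<inter> E) \<le> open_content (U \<inter> V) + outer (V - U)"
        using U V by (intro add_mono outer_le_open_content outer_mono) auto
      also have "\<dots> \<le> open_content V"
        by (rule open_content_split[OF U V(1)])
      finally show "outer (U \<inter> E) + outer ((topspace X - U) \<inter> E) \<le> open_content V" .
    qed
    have "E = (U \<inter> E) \<union> ((topspace X - U) \<inter> E)"
      using E by auto
    then show "outer E \<le> outer (U \<inter> E) + outer ((topspace X - U) \<inter> E)"
      using outer_Un_le[of "U \<inter> E" "(topspace X - U) \<inter> E"] E by auto
  qed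
  then show ?thesis
    using openin_subset[OF U] by (auto simp: lambda_system_def)
qed

lemma measure_space_outer: "measure_space (topspace X) (sets (borel_of X)) outer"
proof -
  interpret P: sigma_algebra "topspace X" "Pow (topspace X)"
    by (rule sigma_algebra_Pow)
  let ?L = "lambda_system (topspace X) (Pow (topspace X)) outer"
  have "outer {} = 0"
    by (simp add: outer_open open_content_empty)
  then have "outer_measure_space (Pow (topspace X)) outer"
    unfolding outer_measure_space_def positive_def increasing_def countably_subadditive_def
    using outer_mono outer_UN_le by (auto simp: image_subset_iff)
  then have L: "measure_space (topspace X) ?L outer"
    by (rule P.caratheodory_lemma)
  then have sig: "sigma_algebra (topspace X) ?L"
    by (simp add: measure_space_def)
  have sub: "sets (borel_of X) \<subseteq> ?L"
    unfolding sets_borel_of using open_in_lambda_system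
    by (intro sigma_algebra.sigma_sets_subset[OF sig]) auto
  have "sigma_algebra (topspace X) (sets (borel_of X))"
    using sets.sigma_algebra_axioms[of "borel_of X"] by simp
  then show ?thesis
    using L sub unfolding measure_space_def positive_def countably_additive_def by blast
qed

definition regularisation :: "'a measure" where
  "regularisation = measure_of (topspace X) (sets (borel_of X)) outer"

lemma sets_regularisation [simp]: "sets regularisation = sets (borel_of X)"
  unfolding regularisation_def using sets.space_closed[of "borel_of X"]
  by (metis measure_space_outer measure_space_def sigma_algebra.sets_measure_of_eq)

lemma space_regularisation [simp]: "space regularisation = topspace X"
  using sets_eq_imp_space_eq[OF sets_regularisation] by simp

lemma emeasure_regularisation:
  assumes "B \<in> sets (borel_of X)"
  shows "emeasure regularisation B = outer B"
proof -
  have "measure_space (topspace X) (sets (borel_of X)) outer"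
    by (rule measure_space_outer)
  then show ?thesis
    unfolding regularisation_def
    using assms by (simp add: measure_space_def emeasure_measure_of_sigma)
qed

lemma prob_space_regularisation: "prob_space regularisation"
proof
  have "content (topspace X) = lam (topspace X)"
    by (intro antisym content_le_lam content_greatest) (auto dest!: openin_subset)
  then show "emeasure regularisation (space regularisation) = 1"
    using lam_total by (simp add: emeasure_regularisation openin_borel_of outer_closed)
qed

lemma regularisation_in_prob_measures: "regularisation \<in> prob_measures X"
proof -
  interpret prob_space regularisation
    by (rule prob_space_regularisation)
  have "\<exists>U. openin X U \<and> B \<subseteq> U \<and> measure regularisation U \<le> measure regularisation B + e"
    if B: "B \<in> sets (borel_of X)" and e: "0 < e" for B and e :: real
  proof -
    have "B \<subseteq> topspace X"
      using sets.sets_into_space[OF B] by simp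
    then obtain U where U: "openin X U" "B \<subseteq> U" "open_content U \<le> outer B + ennreal e"
      using outer_approx[of B e] e by blast
    then have "emeasure regularisation U \<le> emeasure regularisation B + ennreal e"
      using B by (simp add: emeasure_regularisation openin_borel_of outer_open)
    then show ?thesis
      using U e by (auto simp: emeasure_eq_measure simp flip: ennreal_plus)
  qed
  then have "regular_measure X regularisation"
    using compact prob_space_regularisation by (intro regular_measureI_outer) auto
  then show ?thesis
    using prob_space_regularisation by (simp add: prob_measures_def)
qed

lemma emeasure_regularisation_closed:
  "closedin X K \<Longrightarrow> emeasure regularisation K = (INF U \<in> {U. openin X U \<and> K \<subseteq> U}. lam U)"
  by (simp add: emeasure_regularisation closedin_borel_of outer_closed content_def)

end

section \<open>Lifting measures through a surjection\<close>

text \<open>The sets of \<open>\<B>\<close> divide the space into finitely many cells, and \<open>lam\<close>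
  is a weighted sum of point masses, one in \<open>A\<close> above each cell.\<close>

lemma finitely_additive_lift_of_finite:
  fixes p :: "'a \<Rightarrow> 'b" and \<nu> :: "'b measure" and \<B> :: "'b set set"
  assumes \<nu>: "prob_space \<nu>" and fin: "finite \<B>" and sub: "\<B> \<subseteq> sets \<nu>"
    and onto: "p ` A = space \<nu>"
  obtains lam :: "'a set \<Rightarrow> real" where
    "\<forall>E. 0 \<le> lam E \<and> lam E \<le> 1"
    "\<forall>E F. E \<inter> F = {} \<longrightarrow> lam (E \<union> F) = lam E + lam F"
    "lam A = 1"
    "\<forall>B\<in>\<B>. lam (p -` B \<inter> A) = measure \<nu> B"
proof -
  interpret prob_space \<nu> by (rule \<nu>)
  \<comment> \<open>\<open>cell y\<close> lists the sets of \<open>\<B>\<close> that contain \<open>y\<close>. The point chosen above \<open>y\<close> depends on this list only, so that it takes finitely many values, each on a Borel set.\<close>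
  define cell where "cell y = {B\<in>\<B>. y \<in> B}" for y
  define point where "point D = (SOME x. x \<in> A \<and> cell (p x) = D)" for D
  have point: "point (cell y) \<in> A" "cell (p (point (cell y))) = cell y" if y: "y \<in> space \<nu>" for y
  proof -
    have "\<exists>x. x \<in> A \<and> cell (p x) = cell y"
      using onto y by (metis imageE)
    from someI_ex[OF this] show "point (cell y) \<in> A" "cell (p (point (cell y))) = cell y"
      unfolding point_def by auto
  qed
  define S where "S E = {y \<in> space \<nu>. point (cell y) \<in> E}" for E
  have S_sets: "S E \<in> sets \<nu>" for E
  proof -
    have cell_sets: "{y \<in> space \<nu>. cell y = D} \<in> sets \<nu>" if D: "D \<subseteq> \<B>" for D
    proof -
      have "{y \<in> space \<nu>. cell y = D} = {y \<in> space \<nu>. \<forall>B\<in>\<B>. y \<in> B \<longleftrightarrow> B \<in> D}"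
        using D by (auto simp: cell_def)
      also have "\<dots> \<in> sets \<nu>"
      proof (rule sets.sets_Collect_finite_All[OF _ fin])
        fix B assume "B \<in> \<B>"
        then have "B \<in> sets \<nu>" using sub by auto
        then have "B \<inter> space \<nu> \<in> sets \<nu>" "space \<nu> - B \<in> sets \<nu>" by auto
        moreover have "{y \<in> space \<nu>. (y \<in> B) = (B \<in> D)} = (if B \<in> D then B \<inter> space \<nu> else space \<nu> - B)"
          by auto
        ultimately show "{y \<in> space \<nu>. (y \<in> B) = (B \<in> D)} \<in> sets \<nu>" by simp
      qed
      finally show ?thesis .
    qed
    have "S E = (\<Union>D\<in>{D. D \<subseteq> \<B> \<and> point D \<in> E}. {y \<in> space \<nu>. cell y = D})"
      by (auto simp: S_def cell_def)
    also have "\<dots> \<in> sets \<nu>"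
      using fin cell_sets by (intro sets.finite_UN) auto
    finally show ?thesis .
  qed
  show thesis
  proof (rule that[of "\<lambda>E. measure \<nu> (S E)"])
    show "\<forall>E. 0 \<le> measure \<nu> (S E) \<and> measure \<nu> (S E) \<le> 1"
      by auto
    show "\<forall>E F. E \<inter> F = {} \<longrightarrow> measure \<nu> (S (E \<union> F)) = measure \<nu> (S E) + measure \<nu> (S F)"
    proof (intro allI impI)
      fix E F :: "'a set" assume "E \<inter> F = {}"
      then have "S (E \<union> F) = S E \<union> S F" "S E \<inter> S F = {}"
        by (auto simp: S_def)
      then show "measure \<nu> (S (E \<union> F)) = measure \<nu> (S E) + measure \<nu> (S F)"
        using S_sets by (simp add: finite_measure_Union)
    qed
    have "S A = space \<nu>"
      using point by (auto simp: S_def)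
    then show "measure \<nu> (S A) = 1"
      by (simp add: prob_space)
    have "S (p -` B \<inter> A) = B" if B: "B \<in> \<B>" for B
    proof -
      have *: "p (point (cell y)) \<in> B \<longleftrightarrow> y \<in> B" if "y \<in> space \<nu>" for y
        using point(2)[OF that] B by (auto simp: cell_def set_eq_iff)
      have "B \<subseteq> space \<nu>"
        using B sub sets.sets_into_space by blast
      then show ?thesis
        using * point by (auto simp: S_def)
    qed
    then show "\<forall>B\<in>\<B>. measure \<nu> (S (p -` B \<inter> A)) = measure \<nu> B"
      by simp
  qed
qed

text \<open>The requirements on \<open>lam\<close> are closed conditions in the compact space of all functions
  from sets to \<open>{0..1}\<close>, and finitely many of them can be met simultaneously by the previous
  lemma.\<close>

lemma finitely_additive_lift:
  fixes p :: "'a \<Rightarrow> 'b" and \<nu> :: "'b measure"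
  assumes \<nu>: "prob_space \<nu>" and onto: "p ` A = space \<nu>"
  obtains lam :: "'a set \<Rightarrow> real" where
    "\<forall>E. 0 \<le> lam E \<and> lam E \<le> 1"
    "\<forall>E F. E \<inter> F = {} \<longrightarrow> lam (E \<union> F) = lam E + lam F"
    "lam A = 1"
    "\<forall>B\<in>sets \<nu>. lam (p -` B \<inter> A) = measure \<nu> B"
proof -
  define T where "T = product_topology (\<lambda>_::'a set. top_of_set {0..1::real}) UNIV"
  have compact: "compact_space T"
    unfolding T_def by (subst compact_space_product_topology) (simp add: compact_space_subtopology)
  have cont: "continuous_map T euclideanreal (\<lambda>lam. lam E)" for E
  proof -
    have "continuous_map T (top_of_set {0..1::real}) (\<lambda>lam. lam E)"
      unfolding T_def by (rule continuous_map_product_projection) simp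
    then show ?thesis
      by (rule continuous_map_into_fulltopology)
  qed
  have closed_eq: "closedin T {lam \<in> topspace T. f lam = g lam}"
    if "continuous_map T euclideanreal f" "continuous_map T euclideanreal g" for f g
    using closedin_continuous_maps_eq[OF _ that] by simp
  define add where "add = {lam \<in> topspace T. \<forall>E F. E \<inter> F = {} \<longrightarrow> lam (E \<union> F) = lam E + lam F}"
  define tot where "tot = {lam \<in> topspace T. lam A = 1}"
  define val where "val B = {lam \<in> topspace T. lam (p -` B \<inter> A) = measure \<nu> B}" for B
  have add: "closedin T add"
  proof -
    have "add = (\<Inter>(E,F)\<in>{(E,F). E \<inter> F = {}}. {lam \<in> topspace T. lam (E \<union> F) = lam E + lam F})"
      unfolding add_def by auto
    also have "closedin T \<dots>"
      by (rule closedin_INT) (auto intro!: closed_eq continuous_map_add cont exI[of _ "{}"])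
    finally show ?thesis .
  qed
  have tot: "closedin T tot"
    unfolding tot_def by (intro closed_eq cont) simp
  have val: "closedin T (val B)" for B
    unfolding val_def by (intro closed_eq cont) simp
  have "\<Inter>({add, tot} \<union> val ` sets \<nu>) \<noteq> {}"
  proof (rule compact[unfolded compact_space_fip, rule_format], intro conjI allI impI ballI)
    show "closedin T C" if "C \<in> {add, tot} \<union> val ` sets \<nu>" for C
      using that add tot val by auto
    fix \<F> assume \<F>: "finite \<F> \<and> \<F> \<subseteq> {add, tot} \<union> val ` sets \<nu>"
    then have "finite (\<F> - {add, tot})" "\<F> - {add, tot} \<subseteq> val ` sets \<nu>"
      by auto
    then obtain \<B> where \<B>: "finite \<B>" "\<B> \<subseteq> sets \<nu>" "\<F> - {add, tot} = val ` \<B>"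
      by (metis finite_subset_image)
    obtain lam :: "'a set \<Rightarrow> real" where lam:
      "\<forall>E. 0 \<le> lam E \<and> lam E \<le> 1"
      "\<forall>E F. E \<inter> F = {} \<longrightarrow> lam (E \<union> F) = lam E + lam F" "lam A = 1"
      "\<forall>B\<in>\<B>. lam (p -` B \<inter> A) = measure \<nu> B"
      using finitely_additive_lift_of_finite[OF \<nu> \<B>(1,2) onto] .
    have "lam \<in> topspace T"
      unfolding T_def using lam(1) by auto
    then have "lam \<in> add" "lam \<in> tot" "\<And>B. B \<in> \<B> \<Longrightarrow> lam \<in> val B"
      using lam by (auto simp: add_def tot_def val_def)
    then have "lam \<in> \<Inter>\<F>"
      using \<B>(3) by blast
    then show "\<Inter>\<F> \<noteq> {}" by blast
  qed
  then obtain lam where lam: "lam \<in> add" "lam \<in> tot" "\<And>B. B \<in> sets \<nu> \<Longrightarrow> lam \<in> val B"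
    by blast
  then have "lam \<in> topspace T" by (simp add: add_def)
  then have "0 \<le> lam E \<and> lam E \<le> 1" for E
    unfolding T_def by (auto simp: PiE_def Pi_def)
  then show thesis
    using lam by (intro that[of lam]) (auto simp: add_def tot_def val_def)
qed

text \<open>The lift is the regular measure induced by a finitely additive lift of \<open>\<nu>\<close>. On
  the preimage of a closed set \<open>C\<close>, its value is at least \<open>\<nu> C\<close> by monotonicity,
  and at most \<open>\<nu> V\<close> for every open \<open>V \<supseteq> C\<close>; outer regularity of
  \<open>\<nu>\<close> closes the gap. Concentration on a prescribed closed set \<open>A\<close> is what the
  converse direction for irreducible maps needs.\<close>

theorem measure_lift:
  assumes X: "compact_space X" "Hausdorff_space X" and Y: "Hausdorff_space Y"
    and p: "continuous_map X Y p" and A: "closedin X A" and onto: "p ` A = topspace Y"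
    and \<nu>: "\<nu> \<in> prob_measures Y"
  obtains \<mu> where "\<mu> \<in> prob_measures X" "push_measure Y p \<mu> = \<nu>" "emeasure \<mu> A = 1"
proof -
  interpret N: prob_space \<nu> using \<nu> by (rule prob_space_prob_measures)
  have pA: "p ` A = space \<nu>"
    using onto space_prob_measures[OF \<nu>] by simp
  obtain lam :: "'a set \<Rightarrow> real" where
    bounds: "\<forall>E. 0 \<le> lam E \<and> lam E \<le> 1"
    and add: "\<forall>E F. E \<inter> F = {} \<longrightarrow> lam (E \<union> F) = lam E + lam F" and lamA: "lam A = 1"
    and val: "\<forall>B\<in>sets \<nu>. lam (p -` B \<inter> A) = measure \<nu> B"
    using finitely_additive_lift[OF N.prob_space_axioms pA] .
  have lam: "0 \<le> lam E" "lam E \<le> 1" "E \<inter> F = {} \<Longrightarrow> lam (E \<union> F) = lam E + lam F" for E F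
    using bounds add by auto
  have mono: "lam E \<le> lam F" if "E \<subseteq> F" for E F
    using lam(3)[of E "F - E"] lam(1)[of "F - E"] that by (simp add: Un_absorb1)
  have top: "lam E = 1" if "A \<subseteq> E" for E
    using mono[OF that] lam(2)[of E] lamA by simp
  \<comment> \<open>All mass lies on \<open>A\<close>, so restricting to \<open>A\<close> is harmless.\<close>
  have restr: "lam (E \<inter> A) = lam E" for E
  proof -
    have "lam (A \<union> E) = lam A + lam (E - A)"
      using lam(3)[of A "E - A"] by simp
    then have "lam (E - A) = 0"
      using lamA top[of "A \<union> E"] by simp
    moreover have "lam (E \<inter> A \<union> (E - A)) = lam (E \<inter> A) + lam (E - A)"
      by (intro lam(3)) auto
    moreover have "E \<inter> A \<union> (E - A) = E" by auto
    ultimately show ?thesis by simp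
  qed
  have At: "A \<subseteq> topspace X"
    using A by (rule closedin_subset)
  interpret additive_set_function X "\<lambda>E. ennreal (lam E)"
  proof
    show "ennreal (lam {}) = 0"
    proof -
      have "lam ({} \<union> {}) = lam {} + lam {}"
        by (rule lam(3)) simp
      moreover have "lam ({} \<union> {}) = lam {}" by simp
      ultimately have "lam {} = 0" by linarith
      then show ?thesis by simp
    qed
    show "ennreal (lam (topspace X)) = 1"
      using top[OF At] by simp
    show "ennreal (lam (E \<union> F)) = ennreal (lam E) + ennreal (lam F)" if "E \<inter> F = {}" for E F
      using lam(3)[OF that] lam(1)[of E] lam(1)[of F] by (simp add: ennreal_plus)
  qed (use X in auto)
  have R: "regularisation \<in> prob_measures X"
    by (rule regularisation_in_prob_measures)
  interpret R: prob_space regularisation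
    by (rule prob_space_regularisation)
  have push: "push_measure Y p regularisation = \<nu>"
  proof (rule prob_measures_eqI[OF push_measure_in_prob_measures[OF Y p R] \<nu>])
    fix C assume C: "closedin Y C"
    have Cs: "C \<in> sets (borel_of Y)"
      using C by (rule closedin_borel_of)
    have lam_vimage: "ennreal (lam (p -` B \<inter> topspace X)) = emeasure \<nu> B"
      if "B \<in> sets (borel_of Y)" for B
    proof -
      have "lam (p -` B \<inter> topspace X) = lam ((p -` B \<inter> topspace X) \<inter> A)"
        by (rule restr[symmetric])
      also have "(p -` B \<inter> topspace X) \<inter> A = p -` B \<inter> A"
        using At by auto
      finally show ?thesis
        using val that sets_prob_measures[OF \<nu>] by (simp add: N.emeasure_eq_measure)
    qed
    let ?K = "p -` C \<inter> topspace X"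
    have "closedin X ?K"
    proof -
      have "?K = {x \<in> topspace X. p x \<in> C}" by auto
      then show ?thesis
        using closedin_continuous_map_preimage[OF p C] by simp
    qed
    then have "emeasure (push_measure Y p regularisation) C
        = (INF U \<in> {U. openin X U \<and> ?K \<subseteq> U}. ennreal (lam U))"
      using emeasure_push_measure[OF R p Cs] emeasure_regularisation_closed by simp
    also have "\<dots> = emeasure \<nu> C"
    proof (rule antisym)
      have "emeasure \<nu> C = (INF V \<in> {V. openin Y V \<and> C \<subseteq> V}. emeasure \<nu> V)"
        using \<nu> Cs unfolding prob_measures_def regular_measure_def by blast
      also have "\<dots> \<ge> (INF U \<in> {U. openin X U \<and> ?K \<subseteq> U}. ennreal (lam U))"
      proof (rule INF_greatest)
        fix V assume V: "V \<in> {V. openin Y V \<and> C \<subseteq> V}"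
        have "openin X (p -` V \<inter> topspace X)"
        proof -
          have "p -` V \<inter> topspace X = {x \<in> topspace X. p x \<in> V}" by auto
          then show ?thesis
            using openin_continuous_map_preimage[OF p, of V] V by simp
        qed
        then have "(INF U \<in> {U. openin X U \<and> ?K \<subseteq> U}. ennreal (lam U)) \<le> ennreal (lam (p -` V \<inter> topspace X))"
          using V by (intro INF_lower) auto
        then show "(INF U \<in> {U. openin X U \<and> ?K \<subseteq> U}. ennreal (lam U)) \<le> emeasure \<nu> V"
          using lam_vimage[of V] V by (simp add: openin_borel_of)
      qed
      finally show "(INF U \<in> {U. openin X U \<and> ?K \<subseteq> U}. ennreal (lam U)) \<le> emeasure \<nu> C" .
      show "emeasure \<nu> C \<le> (INF U \<in> {U. openin X U \<and> ?K \<subseteq> U}. ennreal (lam U))"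
        unfolding lam_vimage[OF Cs, symmetric] by (rule INF_greatest) (use mono in \<open>auto intro!: ennreal_leI\<close>)
    qed
    finally show "emeasure (push_measure Y p regularisation) C = emeasure \<nu> C" .
  qed
  have "1 \<le> emeasure regularisation A"
    unfolding emeasure_regularisation_closed[OF A] using top by (intro INF_greatest) auto
  then have "emeasure regularisation A = 1"
    using R.measure_le_1[of A] by (intro antisym)
  with R push show thesis
    by (rule that)
qed

section \<open>The weak* topology\<close>

lemma continuous_map_integral:
  assumes f: "f \<in> cont_funs X"
  shows "continuous_map (measure_topology X) euclideanreal (\<lambda>\<mu>. integral\<^sup>L \<mu> f)"
proof -
  have "continuous_map (measure_topology X) euclideanreal
      ((\<lambda>\<phi>. \<phi> f) \<circ> (\<lambda>\<mu>. \<lambda>f\<in>cont_funs X. integral\<^sup>L \<mu> f))"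
    unfolding measure_topology_def
    by (rule continuous_map_pullback) (rule continuous_map_product_projection[OF f])
  then show ?thesis
    using f by (simp add: o_def)
qed

lemma continuous_map_into_measure_topology:
  assumes "\<And>z. z \<in> topspace Z \<Longrightarrow> g z \<in> prob_measures X"
    and "\<And>f. f \<in> cont_funs X \<Longrightarrow> continuous_map Z euclideanreal (\<lambda>z. integral\<^sup>L (g z) f)"
  shows "continuous_map Z (measure_topology X) g"
  unfolding measure_topology_def
proof (rule continuous_map_pullback')
  show "continuous_map Z (product_topology (\<lambda>_. euclideanreal) (cont_funs X))
      ((\<lambda>\<mu>. \<lambda>f\<in>cont_funs X. integral\<^sup>L \<mu> f) \<circ> g)"
    unfolding continuous_map_componentwise using assms(2) by (auto simp: o_def extensional_def)
  show "topspace Z \<subseteq> g -` prob_measures X"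
    using assms(1) by auto
qed

lemma continuous_map_push_measure:
  assumes Y: "Hausdorff_space Y" and p: "continuous_map X Y p"
  shows "continuous_map (measure_topology X) (measure_topology Y) (push_measure Y p)"
proof (rule continuous_map_into_measure_topology)
  show "push_measure Y p \<mu> \<in> prob_measures Y" if "\<mu> \<in> topspace (measure_topology X)" for \<mu>
    using that push_measure_in_prob_measures[OF Y p] by simp
  fix f assume f: "f \<in> cont_funs Y"
  then have "f \<circ> p \<in> cont_funs X"
    using p by (simp add: cont_funs_def continuous_map_compose)
  then have "continuous_map (measure_topology X) euclideanreal (\<lambda>\<mu>. integral\<^sup>L \<mu> (f \<circ> p))"
    by (rule continuous_map_integral)
  then show "continuous_map (measure_topology X) euclideanreal (\<lambda>\<mu>. integral\<^sup>L (push_measure Y p \<mu>) f)"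
    by (rule continuous_map_eq) (simp add: integral_push_measure[OF p _ f])
qed

lemma measure_topology_neighbourhood:
  assumes U: "openin (measure_topology X) \<U>" and \<mu>: "\<mu> \<in> \<U>"
  obtains F e where "finite F" "F \<subseteq> cont_funs X" "0 < (e::real)"
    "\<And>\<mu>'. \<mu>' \<in> prob_measures X \<Longrightarrow> (\<And>f. f \<in> F \<Longrightarrow> \<bar>integral\<^sup>L \<mu>' f - integral\<^sup>L \<mu> f\<bar> < e) \<Longrightarrow> \<mu>' \<in> \<U>"
proof -
  let ?ev = "\<lambda>\<mu>. \<lambda>f\<in>cont_funs X. integral\<^sup>L \<mu> f"
  obtain V where V: "openin (product_topology (\<lambda>_. euclideanreal) (cont_funs X)) V"
    "\<U> = ?ev -` V \<inter> prob_measures X"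
    using U unfolding measure_topology_def openin_pullback_topology by blast
  then have "?ev \<mu> \<in> V" using \<mu> by blast
  then obtain B where B: "finite {f \<in> cont_funs X. B f \<noteq> UNIV}" "\<forall>f\<in>cont_funs X. open (B f)"
    "?ev \<mu> \<in> Pi\<^sub>E (cont_funs X) B" "Pi\<^sub>E (cont_funs X) B \<subseteq> V"
    using V(1) unfolding openin_product_topology_alt by fastforce
  define F where "F = {f \<in> cont_funs X. B f \<noteq> UNIV}"
  have "\<exists>e>0. \<forall>y. \<bar>y - integral\<^sup>L \<mu> f\<bar> < e \<longrightarrow> y \<in> B f" if "f \<in> F" for f
  proof -
    have "open (B f)" "integral\<^sup>L \<mu> f \<in> B f"
      using that B(2,3) by (auto simp: F_def PiE_iff)
    then show ?thesis
      unfolding open_dist dist_real_def by blast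
  qed
  then obtain e where e: "\<And>f. f \<in> F \<Longrightarrow> 0 < e f"
    "\<And>f y. f \<in> F \<Longrightarrow> \<bar>y - integral\<^sup>L \<mu> f\<bar> < e f \<Longrightarrow> y \<in> B f"
    by metis
  have finF: "finite F" using B(1) by (simp add: F_def)
  define m where "m = Min (insert 1 (e ` F))"
  have m: "0 < m" "\<And>f. f \<in> F \<Longrightarrow> m \<le> e f"
    using finF e(1) by (auto simp: m_def)
  show thesis
  proof (rule that[OF finF _ m(1)])
    show "F \<subseteq> cont_funs X" by (auto simp: F_def)
    fix \<mu>' assume \<mu>': "\<mu>' \<in> prob_measures X"
      and close: "\<And>f. f \<in> F \<Longrightarrow> \<bar>integral\<^sup>L \<mu>' f - integral\<^sup>L \<mu> f\<bar> < m"
    have "integral\<^sup>L \<mu>' f \<in> B f" if "f \<in> cont_funs X" for f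
    proof (cases "f \<in> F")
      case True
      then show ?thesis using e(2) close m(2) by fastforce
    next
      case False
      then show ?thesis using that by (simp add: F_def)
    qed
    then have "?ev \<mu>' \<in> V"
      using B(4) by fastforce
    then show "\<mu>' \<in> \<U>" using V(2) \<mu>' by simp
  qed
qed

lemma dense_in_measure_topologyI:
  assumes "\<And>\<mu> F e. \<mu> \<in> prob_measures X \<Longrightarrow> finite F \<Longrightarrow> F \<subseteq> cont_funs X \<Longrightarrow> 0 < (e::real) \<Longrightarrow>
    \<exists>\<mu>'\<in>D \<inter> prob_measures X. \<forall>f\<in>F. \<bar>integral\<^sup>L \<mu>' f - integral\<^sup>L \<mu> f\<bar> < e"
  shows "measure_topology X closure_of D = topspace (measure_topology X)"
  unfolding dense_intersects_open
proof (intro allI impI)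
  fix \<U> assume U: "openin (measure_topology X) \<U> \<and> \<U> \<noteq> {}"
  then obtain \<mu> where \<mu>: "\<mu> \<in> \<U>" by blast
  then have "\<mu> \<in> prob_measures X"
    using U openin_subset by fastforce
  obtain F e where Fe: "finite F" "F \<subseteq> cont_funs X" "0 < (e::real)"
    "\<And>\<mu>'. \<mu>' \<in> prob_measures X \<Longrightarrow> (\<And>f. f \<in> F \<Longrightarrow> \<bar>integral\<^sup>L \<mu>' f - integral\<^sup>L \<mu> f\<bar> < e) \<Longrightarrow> \<mu>' \<in> \<U>"
    by (rule measure_topology_neighbourhood[OF conjunct1[OF U] \<mu>]) blast
  then show "D \<inter> \<U> \<noteq> {}"
    using assms[OF \<open>\<mu> \<in> prob_measures X\<close> Fe(1-3)] by blast
qed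

lemma integrable_cont_funs:
  assumes X: "compact_space X" and \<mu>: "\<mu> \<in> prob_measures X" and f: "f \<in> cont_funs X"
  shows "integrable \<mu> f"
proof -
  interpret prob_space \<mu> using \<mu> by (rule prob_space_prob_measures)
  have cf: "continuous_map X euclideanreal f"
    using f by (simp add: cont_funs_def)
  have "borel_of (euclideanreal) = borel"
    by (simp add: borel_of_def borel_def)
  then have m: "f \<in> borel_measurable \<mu>"
    using measurable_prob_measures[OF \<mu> cf] by simp
  have "compactin euclideanreal (f ` topspace X)"
    using image_compactin[OF _ cf] X by (simp add: compact_space_def)
  then obtain b where b: "\<And>x. x \<in> topspace X \<Longrightarrow> norm (f x) \<le> b"
    using compact_imp_bounded bounded_iff by (metis (no_types, lifting) compactin_euclidean_iff imageI)
  show ?thesis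
    using b m space_prob_measures[OF \<mu>] by (intro integrable_const_bound[of _ b]) auto
qed

lemma (in prob_space) integral_close:
  fixes f g :: "'a \<Rightarrow> real"
  assumes "integrable M f" "integrable M g" and close: "AE x in M. \<bar>f x - g x\<bar> \<le> c"
  shows "\<bar>integral\<^sup>L M f - integral\<^sup>L M g\<bar> \<le> c"
proof -
  have "\<bar>integral\<^sup>L M f - integral\<^sup>L M g\<bar> = \<bar>\<integral>x. f x - g x \<partial>M\<bar>"
    using assms by simp
  also have "\<dots> \<le> (\<integral>x. \<bar>f x - g x\<bar> \<partial>M)"
    by (rule integral_abs_bound)
  also have "\<dots> \<le> (\<integral>x. c \<partial>M)"
    using assms by (intro integral_mono_AE) auto
  also have "\<dots> = c"
    by (simp add: prob_space)
  finally show ?thesis .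
qed

lemma continuous_surjection_push_measure:
  assumes "compact_space X" "Hausdorff_space X" "Hausdorff_space Y" "continuous_surjection X Y p"
  shows "continuous_surjection (measure_topology X) (measure_topology Y) (push_measure Y p)"
proof -
  have p: "continuous_map X Y p" "p ` topspace X = topspace Y"
    using assms(4) by (auto simp: continuous_surjection_def)
  have "prob_measures Y \<subseteq> push_measure Y p ` prob_measures X"
    using measure_lift[OF assms(1-3) p(1) closedin_topspace p(2)] by (metis image_eqI subsetI)
  then show ?thesis
    unfolding continuous_surjection_def
    using continuous_map_push_measure[OF assms(3) p(1)] push_measure_in_prob_measures[OF assms(3) p(1)] by auto
qed

text \<open>By inner regularity and Urysohn's lemma, a regular measure is concentrated on \<open>A\<close>
  exactly if it annihilates all continuous functions that vanish on \<open>A\<close>.\<close>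

lemma closedin_measures_concentrated_on:
  assumes X: "compact_space X" "Hausdorff_space X" and A: "closedin X A"
  shows "closedin (measure_topology X) {\<mu> \<in> prob_measures X. emeasure \<mu> A = 1}"
proof -
  define G where "G = {f \<in> cont_funs X. \<forall>x\<in>A. f x = 0}"
  have normal: "normal_space X"
    using X by (simp add: compact_Hausdorff_or_regular_imp_normal_space)
  have Ab: "A \<in> sets (borel_of X)"
    using A by (rule closedin_borel_of)
  have "{\<mu> \<in> prob_measures X. emeasure \<mu> A = 1} = (\<Inter>f\<in>G. {\<mu> \<in> prob_measures X. integral\<^sup>L \<mu> f = 0})"
    (is "?L = ?R")
  proof (rule equalityI; rule subsetI)
    fix \<mu> assume "\<mu> \<in> ?L"
    then have \<mu>: "\<mu> \<in> prob_measures X" "emeasure \<mu> A = 1" by auto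
    interpret prob_space \<mu> using \<mu>(1) by (rule prob_space_prob_measures)
    have AE: "AE x in \<mu>. x \<in> A"
      using \<mu> Ab sets_prob_measures[OF \<mu>(1)] by (simp add: emeasure_eq_measure AE_in_set_eq_1)
    have "integral\<^sup>L \<mu> f = 0" if "f \<in> G" for f
      using AE that by (intro integral_eq_zero_AE) (auto simp: G_def elim!: eventually_mono)
    then show "\<mu> \<in> ?R" using \<mu>(1) by auto
  next
    fix \<mu> assume R: "\<mu> \<in> ?R"
    have "(\<lambda>_. 0) \<in> G" by (simp add: G_def cont_funs_def)
    then have \<mu>: "\<mu> \<in> prob_measures X" using R by blast
    interpret prob_space \<mu> using \<mu> by (rule prob_space_prob_measures)
    have st: "sets \<mu> = sets (borel_of X)" and sp: "space \<mu> = topspace X"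
      using sets_prob_measures[OF \<mu>] space_prob_measures[OF \<mu>] .
    have B: "topspace X - A \<in> sets (borel_of X)"
      using A by (intro openin_borel_of) auto
    have null: "emeasure \<mu> K = 0" if K: "closedin X K" "K \<subseteq> topspace X - A" for K
    proof -
      have "disjnt A K" using K(2) by (auto simp: disjnt_def)
      then obtain f where f: "continuous_map X (top_of_set {0..1::real}) f" "f ` A \<subseteq> {0}" "f ` K \<subseteq> {1}"
        using Urysohn_lemma[OF normal A K(1), of 0 1] by auto
      then have fX: "f \<in> cont_funs X" and f01: "\<And>x. x \<in> topspace X \<Longrightarrow> f x \<in> {0..1}"
        unfolding cont_funs_def continuous_map_in_subtopology by auto
      have Ks: "K \<in> sets \<mu>" using closedin_borel_of[OF K(1)] st by simp
      have "f \<in> G" using fX f(2) by (auto simp: G_def)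
      then have "integral\<^sup>L \<mu> f = 0" using R by blast
      moreover have "measure \<mu> K \<le> integral\<^sup>L \<mu> f"
      proof -
        have "measure \<mu> K = (\<integral>x. indicator K x \<partial>\<mu>)"
          using Ks sets.sets_into_space[OF Ks] by (simp add: Int_absorb2)
        also have "\<dots> \<le> integral\<^sup>L \<mu> f"
        proof (rule integral_mono)
          show "integrable \<mu> (indicator K :: 'a \<Rightarrow> real)"
            using Ks by (simp add: emeasure_eq_measure)
          show "integrable \<mu> f"
            by (rule integrable_cont_funs[OF X(1) \<mu> fX])
          show "indicator K x \<le> f x" if "x \<in> space \<mu>" for x
            using f01[of x] f(3) that sp by (auto simp: indicator_def)
        qed
        finally show ?thesis .
      qed
      ultimately show ?thesis
        by (simp add: emeasure_eq_measure measure_le_0_iff)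
    qed
    have "emeasure \<mu> (topspace X - A)
        = (SUP K \<in> {K. compactin X K \<and> closedin X K \<and> K \<subseteq> topspace X - A}. emeasure \<mu> K)"
      using \<mu> B unfolding prob_measures_def regular_measure_def by blast
    also have "\<dots> \<le> 0"
      by (rule SUP_least) (use null in simp)
    finally have "emeasure \<mu> (topspace X - A) \<le> 0" .
    then have "emeasure \<mu> A = 1"
      using prob_compl[of A] Ab st sp by (simp add: emeasure_eq_measure measure_le_0_iff)
    then show "\<mu> \<in> ?L" using \<mu> by simp
  qed
  moreover have "closedin (measure_topology X) ?R"
  proof (rule closedin_INT)
    show "G \<noteq> {}" by (auto simp: G_def cont_funs_def intro!: exI[of _ "\<lambda>_. 0"])
    fix f assume "f \<in> G"
    then have "continuous_map (measure_topology X) euclideanreal (\<lambda>\<mu>. integral\<^sup>L \<mu> f)"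
      by (intro continuous_map_integral) (simp add: G_def)
    from closedin_continuous_maps_eq[OF _ this, of "\<lambda>_. 0"]
    show "closedin (measure_topology X) {\<mu> \<in> prob_measures X. integral\<^sup>L \<mu> f = 0}"
      by simp
  qed
  ultimately show ?thesis by simp
qed

section \<open>Irreducible and almost one-to-one maps\<close>

text \<open>Irreducibility says that the closed set \<open>X - U\<close> does not map onto \<open>Y\<close>;
  take for \<open>V\<close> the complement of its image, which is closed by compactness.\<close>

lemma irreducible_map_fibres_in_open:
  assumes X: "compact_space X" and Y: "Hausdorff_space Y" and irr: "irreducible_map X Y p"
    and U: "openin X U" "U \<noteq> {}"
  obtains V where "openin Y V" "V \<noteq> {}" "{x \<in> topspace X. p x \<in> V} \<subseteq> U"
proof -
  have p: "continuous_map X Y p"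
    using irr by (simp add: irreducible_map_def continuous_surjection_def)
  let ?A = "topspace X - U"
  have A: "closedin X ?A" using U(1) by auto
  then have "compactin Y (p ` ?A)"
    using image_compactin[OF closedin_compact_space[OF X A] p] by simp
  then have "closedin Y (p ` ?A)"
    by (rule compactin_imp_closedin[OF Y])
  then have op: "openin Y (topspace Y - p ` ?A)"
    by (rule openin_diff[OF openin_topspace])
  have "?A \<noteq> topspace X"
    using U openin_subset by blast
  then have "p ` ?A \<noteq> topspace Y"
    using irr A unfolding irreducible_map_def by blast
  moreover have "p ` ?A \<subseteq> topspace Y"
    using continuous_map_image_subset_topspace[OF p] by blast
  ultimately show thesis
    using op by (intro that[of "topspace Y - p ` ?A"]) auto
qed

text \<open>A closed set that maps onto the codomain contains every injectivity point.\<close>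

lemma almost_one_to_one_imp_irreducible:
  assumes "almost_one_to_one Z W p"
  shows "irreducible_map Z W p"
proof -
  have p: "continuous_surjection Z W p" and dense: "Z closure_of (injectivity_points Z p) = topspace Z"
    using assms by (auto simp: almost_one_to_one_def)
  have "A = topspace Z" if A: "closedin Z A" "p ` A = topspace W" for A
  proof -
    have "injectivity_points Z p \<subseteq> A"
    proof
      fix z assume z: "z \<in> injectivity_points Z p"
      then have "p z \<in> p ` A"
        using p A(2) by (auto simp: injectivity_points_def continuous_surjection_def)
      then show "z \<in> A"
        using z closedin_subset[OF A(1)] by (auto simp: injectivity_points_def)
    qed
    then have "topspace Z \<subseteq> A"
      using closure_of_minimal[OF _ A(1)] dense by metis
    then show ?thesis
      using closedin_subset[OF A(1)] by auto
  qed
  then show ?thesis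
    using p by (simp add: irreducible_map_def)
qed

text \<open>For each \<open>n\<close>, the preimages of open sets of \<open>Y\<close> that lie in a ball of
  radius \<open>1/(n+1)\<close> cover a dense open set. A point in the intersection of these sets shares its
  fibre with no other point, and the intersection is dense by Baire's theorem.\<close>

lemma irreducible_metrizable_imp_almost_one_to_one:
  assumes X: "compact_space X" "Hausdorff_space X" "metrizable_space X" and Y: "Hausdorff_space Y"
    and irr: "irreducible_map X Y p"
  shows "almost_one_to_one X Y p"
proof -
  have p: "continuous_map X Y p" "p ` topspace X = topspace Y"
    using irr by (auto simp: irreducible_map_def continuous_surjection_def)
  obtain M d where "Metric_space M d" and XM: "X = Metric_space.mtopology M d"
    using X(3) by (auto simp: metrizable_space_def)
  then interpret Metric_space M d by simp
  have top: "topspace X = M" by (simp add: XM)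
  define Pre where "Pre V = {x \<in> topspace X. p x \<in> V}" for V
  define \<V> where "\<V> n = {V. openin Y V \<and> (\<exists>z\<in>M. Pre V \<subseteq> mball z (inverse (real (Suc n))))}" for n
  define G where "G n = (\<Union>V\<in>\<V> n. Pre V)" for n
  have "openin X (G n)" for n
    unfolding G_def Pre_def \<V>_def using openin_continuous_map_preimage[OF p(1)] by (auto intro!: openin_Union)
  moreover have "X closure_of (G n) = topspace X" for n
    unfolding dense_intersects_open
  proof (intro allI impI)
    fix U assume U: "openin X U \<and> U \<noteq> {}"
    then obtain z where z: "z \<in> U" by blast
    then have zM: "z \<in> M" using U openin_subset top by blast
    let ?U = "U \<inter> mball z (inverse (real (Suc n)))"
    have "openin X ?U" "?U \<noteq> {}"
      using U z zM by (auto simp: XM)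
    then obtain V where V: "openin Y V" "V \<noteq> {}" "{x \<in> topspace X. p x \<in> V} \<subseteq> ?U"
      by (rule irreducible_map_fibres_in_open[OF X(1) Y irr])
    then have VV: "V \<in> \<V> n"
      unfolding \<V>_def Pre_def using zM by (intro CollectI conjI bexI[of _ z]) auto
    obtain y where "y \<in> V" using V(2) by blast
    then obtain x where "x \<in> topspace X" "p x \<in> V"
      using p(2) openin_subset[OF V(1)] by (metis imageE subsetD)
    then have "x \<in> Pre V" and "x \<in> U"
      using V(3) by (auto simp: Pre_def)
    then have "x \<in> G n"
      using VV by (auto simp: G_def)
    then show "G n \<inter> U \<noteq> {}" using \<open>x \<in> U\<close> by blast
  qed
  ultimately have dense: "X closure_of \<Inter>(range G) = topspace X"
    using X compact_imp_locally_compact_space compact_Hausdorff_imp_regular_space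
    by (intro Baire_category) auto
  have "\<Inter>(range G) \<subseteq> injectivity_points X p"
  proof
    fix x assume "x \<in> \<Inter>(range G)"
    then have xG: "\<And>n. x \<in> G n" by blast
    then have x: "x \<in> topspace X" by (auto simp: G_def Pre_def)
    have "x' = x" if x': "x' \<in> topspace X" "p x' = p x" for x'
    proof -
      have lt: "d x x' < 2 * inverse (real (Suc n))" for n
      proof -
        obtain V z where "z \<in> M" "Pre V \<subseteq> mball z (inverse (real (Suc n)))" "x \<in> Pre V"
          using xG[of n] by (auto simp: G_def \<V>_def)
        moreover from this have "x' \<in> Pre V" using x' by (auto simp: Pre_def)
        ultimately have "d z x < inverse (real (Suc n))" "d z x' < inverse (real (Suc n))" "z \<in> M"
          by auto
        moreover have "d x x' \<le> d x z + d z x'"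
          using triangle x x'(1) top \<open>z \<in> M\<close> by simp
        ultimately show ?thesis
          using commute[of x z] by linarith
      qed
      have "d x x' \<le> 0"
      proof (rule ccontr)
        assume "\<not> d x x' \<le> 0"
        then obtain n where "inverse (real (Suc n)) < d x x' / 2"
          using reals_Archimedean[of "d x x' / 2"] by auto
        then show False using lt[of n] by simp
      qed
      then have "d x x' = 0"
        using nonneg[of x x'] by linarith
      then show ?thesis
        using zero[of x x'] x x'(1) top by simp
    qed
    then show "x \<in> injectivity_points X p"
      using x by (auto simp: injectivity_points_def)
  qed
  then have "X closure_of (injectivity_points X p) = topspace X"
    using dense closure_of_mono[of "\<Inter>(range G)" "injectivity_points X p" X]
      closure_of_subset_topspace[of X "injectivity_points X p"] by blast
  then show ?thesis
    using irr by (simp add: almost_one_to_one_def irreducible_map_def)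
qed

section \<open>Approximation by measures on finitely many fibres\<close>

text \<open>Points are moved only within open sets on which the functions in \<open>F\<close> vary little. The
  map \<open>h\<close> takes \<open>x\<close> to a point of \<open>S\<close> whose fibre lies in the first of
  finitely many such sets that contains \<open>x\<close>; hence the values of \<open>F\<close> on the whole
  fibre of \<open>h x\<close> are close to those at \<open>x\<close>.\<close>

lemma discretisation:
  assumes X: "compact_space X" "topspace X \<noteq> {}"
    and F: "finite F" "F \<subseteq> cont_funs X" and e: "0 < (e::real)"
    and S: "S \<subseteq> topspace X"
      "\<forall>W. openin X W \<and> W \<noteq> {} \<longrightarrow> (\<exists>z\<in>S. {x \<in> topspace X. p x = p z} \<subseteq> W)"
  obtains h where "h \<in> measurable (borel_of X) (borel_of X)" "finite (h ` topspace X)"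
    "h ` topspace X \<subseteq> S"
    "\<forall>f\<in>F. \<forall>x\<in>topspace X. \<forall>x'\<in>topspace X. p x' = p (h x) \<longrightarrow> \<bar>f x' - f x\<bar> < e"
proof -
  define W where "W c = {x \<in> topspace X. \<forall>f\<in>F. \<bar>f x - f c\<bar> < e/2}" for c
  have openW: "openin X (W c)" for c
  proof -
    have "openin X {x \<in> topspace X. \<bar>f x - f c\<bar> < e/2}" if "f \<in> F" for f
    proof -
      have "continuous_map X euclideanreal (\<lambda>x. \<bar>f x - f c\<bar>)"
        using F(2) that by (intro continuous_map_real_abs continuous_map_diff) (auto simp: cont_funs_def)
      then show ?thesis
        unfolding continuous_map_upper_lower_semicontinuous_lt by blast
    qed
    moreover have "W c = topspace X \<inter> (\<Inter>f\<in>F. {x \<in> topspace X. \<bar>f x - f c\<bar> < e/2})"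
      by (auto simp: W_def)
    ultimately show ?thesis
      using F(1) by (cases "F = {}") (auto intro!: openin_Int openin_Inter)
  qed
  have inW: "c \<in> W c" if "c \<in> topspace X" for c
    using that e by (simp add: W_def)
  have "\<exists>z\<in>S. {x \<in> topspace X. p x = p z} \<subseteq> W c" if "c \<in> topspace X" for c
    using S(2) openW[of c] inW[OF that] by blast
  then obtain z where z: "\<And>c. c \<in> topspace X \<Longrightarrow> z c \<in> S"
    "\<And>c. c \<in> topspace X \<Longrightarrow> {x \<in> topspace X. p x = p (z c)} \<subseteq> W c"
    by metis
  have "\<exists>\<F>. finite \<F> \<and> \<F> \<subseteq> W ` topspace X \<and> topspace X \<subseteq> \<Union>\<F>"
    using X(1) openW inW unfolding compact_space_alt by (auto dest!: spec[of _ "W ` topspace X"])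
  then obtain I where I: "finite I" "I \<subseteq> topspace X" "topspace X \<subseteq> \<Union>(W ` I)"
    by (metis finite_subset_image)
  have "I \<noteq> {}" using I(3) X(2) by auto
  \<comment> \<open>Enumerating the finite cover by \<open>nat\<close> makes the index of the first member that contains \<open>x\<close> a measurable function of \<open>x\<close>.\<close>
  define c where "c = from_nat_into I"
  have c: "range c = I"
    unfolding c_def using \<open>I \<noteq> {}\<close> I(1) by (simp add: range_from_nat_into countable_finite)
  then have ctop: "c k \<in> topspace X" for k
    using I(2) by blast
  define i where "i x = (LEAST k. x \<in> W (c k))" for x
  define h where "h x = z (c (i x))" for x
  have i: "x \<in> W (c (i x))" if "x \<in> topspace X" for x
  proof -
    have "\<exists>k. x \<in> W (c k)"
      using I(3) that c by blast
    then show ?thesis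
      unfolding i_def by (rule LeastI_ex)
  qed
  show thesis
  proof (rule that[of h])
    have "i \<in> measurable (borel_of X) (count_space UNIV)"
      unfolding i_def
    proof (rule measurable_Least)
      fix k show "Measurable.pred (borel_of X) (\<lambda>x. x \<in> W (c k))"
        using openin_borel_of[OF openW] by (rule pred_sets2) auto
    qed
    moreover have "(\<lambda>k. z (c k)) \<in> measurable (count_space UNIV) (borel_of X)"
      using z(1)[OF ctop] S(1) by auto
    ultimately show "h \<in> measurable (borel_of X) (borel_of X)"
      unfolding h_def by (rule measurable_compose)
    have "h ` topspace X \<subseteq> z ` I"
      using c by (auto simp: h_def)
    then show "finite (h ` topspace X)"
      using I(1) finite_surj by blast
    show "h ` topspace X \<subseteq> S"
      using z(1) ctop by (auto simp: h_def)
    have "\<bar>f x' - f x\<bar> < e"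
      if f: "f \<in> F" and x: "x \<in> topspace X" "x' \<in> topspace X" "p x' = p (h x)" for f x x'
    proof -
      have "x' \<in> W (c (i x))"
        using z(2)[OF ctop, of "i x"] x unfolding h_def by blast
      then have "\<bar>f x' - f (c (i x))\<bar> < e/2" "\<bar>f x - f (c (i x))\<bar> < e/2"
        using i[OF x(1)] f by (auto simp: W_def)
      then show ?thesis
        by linarith
    qed
    then show "\<forall>f\<in>F. \<forall>x\<in>topspace X. \<forall>x'\<in>topspace X. p x' = p (h x) \<longrightarrow> \<bar>f x' - f x\<bar> < e"
      by blast
  qed
qed

text \<open>Let \<open>\<mu>0\<close> be the image of \<open>\<mu>\<close> under a discretisation
  \<open>h\<close>. A measure \<open>\<mu>'\<close> with the same push-forward lives on the finitely many
  fibres through the range of \<open>h\<close>, where each \<open>f \<in> F\<close> is nearly constant and so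
  nearly a function \<open>g\<close> of the image point. The integrals of \<open>g\<close> depend on the
  push-forward only, so they agree for \<open>\<mu>'\<close> and \<open>\<mu>0\<close>.\<close>

lemma fibre_approximation:
  assumes X: "compact_space X" "Hausdorff_space X" and Y: "Hausdorff_space Y"
    and p: "continuous_map X Y p"
    and S: "S \<subseteq> topspace X"
      "\<forall>W. openin X W \<and> W \<noteq> {} \<longrightarrow> (\<exists>z\<in>S. {x \<in> topspace X. p x = p z} \<subseteq> W)"
    and \<mu>: "\<mu> \<in> prob_measures X"
    and F: "finite F" "F \<subseteq> cont_funs X" and e: "0 < (e::real)"
  obtains \<mu>0 T where "\<mu>0 \<in> prob_measures X" "finite T" "T \<subseteq> S" "emeasure \<mu>0 T = 1"
    "\<forall>\<mu>'\<in>prob_measures X. push_measure Y p \<mu>' = push_measure Y p \<mu>0 \<longrightarrow>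
      (\<forall>f\<in>F. \<bar>integral\<^sup>L \<mu>' f - integral\<^sup>L \<mu> f\<bar> < e)"
proof -
  interpret M: prob_space \<mu> using \<mu> by (rule prob_space_prob_measures)
  have sp: "space \<mu> = topspace X" and st: "sets \<mu> = sets (borel_of X)"
    using space_prob_measures[OF \<mu>] sets_prob_measures[OF \<mu>] .
  have ne: "topspace X \<noteq> {}"
    using M.not_empty sp by simp
  have e4: "0 < e/4" using e by simp
  obtain h where h: "h \<in> measurable (borel_of X) (borel_of X)" "finite (h ` topspace X)"
    "h ` topspace X \<subseteq> S"
    "\<forall>f\<in>F. \<forall>x\<in>topspace X. \<forall>x'\<in>topspace X. p x' = p (h x) \<longrightarrow> \<bar>f x' - f x\<bar> < e/4"
    using discretisation[OF X(1) ne F e4 S] .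
  define T where "T = h ` topspace X"
  define \<mu>0 where "\<mu>0 = distr \<mu> (borel_of X) h"
  have T: "finite T" "T \<subseteq> S" "T \<subseteq> topspace X"
    using h S(1) by (auto simp: T_def)
  have hm: "h \<in> measurable \<mu> (borel_of X)"
    using h(1) measurable_cong_sets[OF st refl] by blast
  have Tb: "T \<in> sets (borel_of X)"
    using closedin_Hausdorff_finite[OF X(2) T(3,1)] by (rule closedin_borel_of)
  have "h -` T \<inter> space \<mu> = space \<mu>"
    by (auto simp: T_def sp)
  then have T1: "emeasure \<mu>0 T = 1"
    using emeasure_distr[OF hm Tb] M.emeasure_space_1 by (simp add: \<mu>0_def)
  have \<mu>0: "\<mu>0 \<in> prob_measures X"
    by (rule finitely_supported_in_prob_measures[OF X _ _ T(1,3) T1])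
      (simp_all add: \<mu>0_def M.prob_space_distr[OF hm])
  \<comment> \<open>\<open>s\<close> selects a point of \<open>T\<close> in each fibre through \<open>T\<close>; distinct points of \<open>T\<close> may share a fibre.\<close>
  define s where "s y = (SOME x. x \<in> T \<and> p x = y)" for y
  have s: "s y \<in> T" "p (s y) = y" if "y \<in> p ` T" for y
  proof -
    have "\<exists>x. x \<in> T \<and> p x = y" using that by auto
    from someI_ex[OF this] show "s y \<in> T" "p (s y) = y" unfolding s_def by auto
  qed
  have pT: "finite (p ` T)" "p ` T \<subseteq> topspace Y"
    using T(1) image_mono[OF T(3), of p] continuous_map_image_subset_topspace[OF p] by auto
  have pTb: "B \<in> sets (borel_of Y)" if "B \<subseteq> p ` T" for B
    by (rule closedin_borel_of, rule closedin_Hausdorff_finite[OF Y])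
      (use that pT finite_subset in blast)+
  have close: "\<bar>integral\<^sup>L \<mu>' f - integral\<^sup>L \<mu> f\<bar> < e"
    if \<mu>': "\<mu>' \<in> prob_measures X" and eq: "push_measure Y p \<mu>' = push_measure Y p \<mu>0" and f: "f \<in> F" for \<mu>' f
  proof -
    interpret M': prob_space \<mu>' using \<mu>' by (rule prob_space_prob_measures)
    have sp': "space \<mu>' = topspace X"
      using space_prob_measures[OF \<mu>'] .
    have fX: "f \<in> cont_funs X" using f F by auto
    \<comment> \<open>\<open>g\<close> is \<open>f \<circ> s\<close> on the finite set \<open>p ` T\<close> and \<open>0\<close> elsewhere; as a simple function it is measurable, whatever the selection \<open>s\<close>.\<close>
    define g where "g y = (\<Sum>w\<in>p ` T. f (s w) * indicator {w} y)" for y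
    have g: "g y = f (s y)" if "y \<in> p ` T" for y
      unfolding g_def using pT(1) that by (subst sum.remove[of _ y]) (auto simp: indicator_def intro!: sum.neutral)
    have gm: "g \<in> borel_measurable (borel_of Y)"
      unfolding g_def using pTb by (intro borel_measurable_sum borel_measurable_times borel_measurable_const borel_measurable_indicator) auto
    have gb: "\<bar>g y\<bar> \<le> (\<Sum>w\<in>p ` T. \<bar>f (s w)\<bar>)" for y
      unfolding g_def by (rule order_trans[OF sum_abs]) (auto intro!: sum_mono simp: indicator_def)
    have pm: "p \<in> measurable \<mu>' (borel_of Y)" "p \<in> measurable \<mu>0 (borel_of Y)"
      "p \<in> measurable (borel_of X) (borel_of Y)"
      using measurable_prob_measures[OF _ p] \<mu>' \<mu>0 measurable_borel_of[OF p] by auto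
    have phm: "(\<lambda>x. p (h x)) \<in> measurable \<mu> (borel_of Y)"
      using measurable_compose[OF hm pm(3)] .
    have int: "integrable \<mu>' (\<lambda>x. g (p x))" "integrable \<mu> (\<lambda>x. g (p (h x)))"
      using gb by (auto intro!:
          M'.integrable_const_bound[OF _ measurable_compose[OF pm(1) gm], of "\<Sum>w\<in>p ` T. \<bar>f (s w)\<bar>"]
          M.integrable_const_bound[OF _ measurable_compose[OF phm gm], of "\<Sum>w\<in>p ` T. \<bar>f (s w)\<bar>"])
    have "integral\<^sup>L \<mu>' (\<lambda>x. g (p x)) = integral\<^sup>L (push_measure Y p \<mu>') g"
      unfolding push_measure_def by (rule integral_distr[OF pm(1) gm, symmetric])
    also have "\<dots> = integral\<^sup>L \<mu>0 (\<lambda>x. g (p x))"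
      unfolding eq unfolding push_measure_def by (rule integral_distr[OF pm(2) gm])
    also have "\<dots> = integral\<^sup>L \<mu> (\<lambda>x. g (p (h x)))"
      unfolding \<mu>0_def by (rule integral_distr[OF hm measurable_compose[OF pm(3) gm]])
    finally have same: "integral\<^sup>L \<mu>' (\<lambda>x. g (p x)) = integral\<^sup>L \<mu> (\<lambda>x. g (p (h x)))" .
    have "\<bar>f x - g (p (h x))\<bar> \<le> e/4" if x: "x \<in> topspace X" for x
    proof -
      have y: "p (h x) \<in> p ` T" using x by (auto simp: T_def)
      have "s (p (h x)) \<in> topspace X"
        using s(1)[OF y] T(3) by blast
      then have "\<bar>f (s (p (h x))) - f x\<bar> < e/4"
        using h(4) f x s(2)[OF y] by blast
      then show ?thesis
        using g[OF y] by linarith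
    qed
    then have 1: "\<bar>integral\<^sup>L \<mu> f - integral\<^sup>L \<mu> (\<lambda>x. g (p (h x)))\<bar> \<le> e/4"
      using sp by (intro M.integral_close integrable_cont_funs[OF X(1) \<mu> fX] int AE_I2) auto
    have "emeasure \<mu>' (p -` (p ` T) \<inter> topspace X) = emeasure \<mu>0 (p -` (p ` T) \<inter> topspace X)"
      using emeasure_push_measure[OF \<mu>' p pTb] emeasure_push_measure[OF \<mu>0 p pTb] eq by simp
    also have "\<dots> \<ge> emeasure \<mu>0 T"
      using T(3) measurable_sets[OF pm(2) pTb] space_prob_measures[OF \<mu>0] by (intro emeasure_mono) auto
    finally have "emeasure \<mu>' (p -` (p ` T) \<inter> topspace X) = 1"
      using T1 M'.measure_le_1[of "p -` (p ` T) \<inter> topspace X"] by (intro antisym) auto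
    then have "AE x in \<mu>'. x \<in> p -` (p ` T) \<inter> topspace X"
      using measurable_sets[OF pm(1) pTb] sp' by (intro M'.AE_in_set_eq_1[THEN iffD2]) (auto simp: M'.emeasure_eq_measure)
    \<comment> \<open>If \<open>s (p x) = h x1\<close>, then \<open>x\<close> and \<open>h x1\<close> lie in the same fibre, on which \<open>f\<close> is within \<open>e/4\<close> of \<open>f x1\<close>.\<close>
    then have "AE x in \<mu>'. \<bar>f x - g (p x)\<bar> \<le> e/4 + e/4"
    proof (rule eventually_mono)
      fix x assume x: "x \<in> p -` (p ` T) \<inter> topspace X"
      then have px: "p x \<in> p ` T" by auto
      then obtain x1 where x1: "x1 \<in> topspace X" "s (p x) = h x1"
        using s(1)[OF px] by (auto simp: T_def)
      have "p x = p (h x1)" "h x1 \<in> topspace X"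
        using s[OF px] x1 T(3) by auto
      then have "\<bar>f x - f x1\<bar> < e/4" "\<bar>f (h x1) - f x1\<bar> < e/4"
        using h(4) f x1(1) x by auto
      then show "\<bar>f x - g (p x)\<bar> \<le> e/4 + e/4"
        unfolding g[OF px] x1(2) by linarith
    qed
    then have 2: "\<bar>integral\<^sup>L \<mu>' f - integral\<^sup>L \<mu>' (\<lambda>x. g (p x))\<bar> \<le> e/4 + e/4"
      by (intro M'.integral_close integrable_cont_funs[OF X(1) \<mu>' fX] int)
    show ?thesis
      using 1 2 same e by linarith
  qed
  show thesis
    by (rule that[OF \<mu>0 T(1,2) T1]) (use close in blast)
qed

text \<open>Subsets of \<open>T\<close> are full preimages of finite sets, so their measure can be read off
  from the push-forward; this applies to \<open>T\<close> itself, so \<open>\<mu>'\<close> is concentrated on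
  \<open>T\<close> as well.\<close>

lemma eq_measure_on_injectivity_points:
  assumes X: "Hausdorff_space X" and Y: "Hausdorff_space Y" and p: "continuous_map X Y p"
    and T: "finite T" "T \<subseteq> injectivity_points X p"
    and \<mu>: "\<mu> \<in> prob_measures X" "emeasure \<mu> T = 1" and \<mu>': "\<mu>' \<in> prob_measures X"
    and eq: "push_measure Y p \<mu>' = push_measure Y p \<mu>"
  shows "\<mu>' = \<mu>"
proof (rule measure_eqI)
  show s: "sets \<mu>' = sets \<mu>"
    using \<mu>(1) \<mu>' by (simp add: prob_measures_def)
  have Tt: "T \<subseteq> topspace X" using T(2) by (auto simp: injectivity_points_def)
  have small: "emeasure \<mu>' E = emeasure \<mu> E" if E: "E \<subseteq> T" for E
  proof -
    have pE: "p ` E \<in> sets (borel_of Y)"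
    proof (rule closedin_borel_of, rule closedin_Hausdorff_finite[OF Y])
      show "p ` E \<subseteq> topspace Y"
        using E Tt continuous_map_image_subset_topspace[OF p] by blast
      show "finite (p ` E)" using E T(1) finite_subset by blast
    qed
    have "x = z" if "x \<in> topspace X" "z \<in> E" "p x = p z" for x z
      using that E T(2) by (auto simp: injectivity_points_def)
    then have "p -` (p ` E) \<inter> topspace X = E"
      using E Tt by auto
    then show ?thesis
      using emeasure_push_measure[OF \<mu>(1) p pE] emeasure_push_measure[OF \<mu>' p pE] eq by simp
  qed
  have Ts: "T \<in> sets \<mu>"
    using closedin_borel_of[OF closedin_Hausdorff_finite[OF X Tt T(1)]] sets_prob_measures[OF \<mu>(1)] by simp
  have restr: "emeasure \<rho> E = emeasure \<rho> (E \<inter> T)"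
    if \<rho>: "\<rho> \<in> prob_measures X" "emeasure \<rho> T = 1" and E: "E \<in> sets \<mu>" for \<rho> E
  proof -
    interpret prob_space \<rho> using \<rho>(1) by (rule prob_space_prob_measures)
    have \<rho>s: "sets \<rho> = sets \<mu>"
      using sets_prob_measures \<rho>(1) \<mu>(1) by metis
    then have "AE x in \<rho>. x \<in> T"
      using \<rho>(2) Ts by (simp add: emeasure_eq_measure AE_in_set_eq_1)
    then show ?thesis
      using E Ts \<rho>s by (intro emeasure_eq_AE) (auto elim!: eventually_mono)
  qed
  fix E assume "E \<in> sets \<mu>'"
  then have E: "E \<in> sets \<mu>" using s by simp
  have "emeasure \<mu>' T = 1" using small[of T] \<mu>(2) by simp
  then show "emeasure \<mu>' E = emeasure \<mu> E"
    using restr[OF \<mu> E] restr[OF \<mu>' _ E] small[of "E \<inter> T"] by simp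
qed

section \<open>The push-forward map\<close>

text \<open>If \<open>A\<close> is a closed set that maps onto \<open>Y\<close>, then the measures
  concentrated on \<open>A\<close> form a closed set that maps onto all measures on \<open>Y\<close>, so every
  measure is concentrated on \<open>A\<close>; a point mass outside \<open>A\<close> is not.\<close>

lemma irreducible_push_measure_imp:
  assumes X: "compact_space X" "Hausdorff_space X" and Y: "Hausdorff_space Y"
    and p: "continuous_surjection X Y p"
    and irr: "irreducible_map (measure_topology X) (measure_topology Y) (push_measure Y p)"
  shows "irreducible_map X Y p"
proof -
  have cp: "continuous_map X Y p" using p by (simp add: continuous_surjection_def)
  have "A = topspace X" if A: "closedin X A" "p ` A = topspace Y" for A
  proof (rule ccontr)
    assume "A \<noteq> topspace X"
    then obtain x where x: "x \<in> topspace X" "x \<notin> A"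
      using closedin_subset[OF A(1)] by blast
    let ?\<A> = "{\<mu> \<in> prob_measures X. emeasure \<mu> A = 1}"
    have "push_measure Y p ` ?\<A> = prob_measures Y"
    proof (intro equalityI subsetI)
      show "\<nu> \<in> prob_measures Y" if "\<nu> \<in> push_measure Y p ` ?\<A>" for \<nu>
        using that push_measure_in_prob_measures[OF Y cp] by blast
      show "\<nu> \<in> push_measure Y p ` ?\<A>" if \<nu>: "\<nu> \<in> prob_measures Y" for \<nu>
      proof -
        obtain \<mu> where "\<mu> \<in> prob_measures X" "push_measure Y p \<mu> = \<nu>" "emeasure \<mu> A = 1"
          using measure_lift[OF X Y cp A \<nu>] .
        then show ?thesis by blast
      qed
    qed
    then have all: "?\<A> = prob_measures X"
      using irr closedin_measures_concentrated_on[OF X A(1)]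
      unfolding irreducible_map_def topspace_measure_topology by blast
    let ?\<delta> = "return (borel_of X) x"
    have "{x} \<in> sets (borel_of X)"
      using closedin_Hausdorff_singleton[OF X(2) x(1)] by (rule closedin_borel_of)
    then have "?\<delta> \<in> prob_measures X"
      using x(1) prob_space_return[of x "borel_of X"]
      by (intro finitely_supported_in_prob_measures[OF X, of _ "{x}"]) simp_all
    then have "emeasure ?\<delta> A = 1"
      using all by blast
    then show False
      using x(2) closedin_borel_of[OF A(1)] by simp
  qed
  then show ?thesis
    using p by (simp add: irreducible_map_def)
qed

text \<open>A closed set \<open>\<A>\<close> that is mapped onto all measures on \<open>Y\<close> contains
  some measure with the push-forward of the approximant \<open>\<mu>0\<close> of \<open>\<mu>\<close>. It need
  not be \<open>\<mu>0\<close>, but it is close to \<open>\<mu>\<close> all the same.\<close>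

lemma irreducible_push_measure:
  assumes X: "compact_space X" "Hausdorff_space X" and Y: "Hausdorff_space Y"
    and irr: "irreducible_map X Y p"
  shows "irreducible_map (measure_topology X) (measure_topology Y) (push_measure Y p)"
proof -
  have p: "continuous_surjection X Y p" using irr by (simp add: irreducible_map_def)
  then have cp: "continuous_map X Y p" by (simp add: continuous_surjection_def)
  have "\<exists>z\<in>topspace X. {x \<in> topspace X. p x = p z} \<subseteq> W" if W: "openin X W" "W \<noteq> {}" for W
  proof -
    obtain V where V: "openin Y V" "V \<noteq> {}" "{x \<in> topspace X. p x \<in> V} \<subseteq> W"
      using irreducible_map_fibres_in_open[OF X(1) Y irr W] .
    obtain y where y: "y \<in> V" using V(2) by blast
    then have "y \<in> p ` topspace X"
      using p openin_subset[OF V(1)] by (auto simp: continuous_surjection_def)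
    then obtain z where "z \<in> topspace X" "p z = y" by blast
    then show ?thesis using V(3) y by (intro bexI[of _ z]) auto
  qed
  then have fib: "\<forall>W. openin X W \<and> W \<noteq> {} \<longrightarrow> (\<exists>z\<in>topspace X. {x \<in> topspace X. p x = p z} \<subseteq> W)"
    by blast
  have "\<A> = prob_measures X"
    if \<A>: "closedin (measure_topology X) \<A>" "push_measure Y p ` \<A> = prob_measures Y" for \<A>
  proof -
    have sub: "\<A> \<subseteq> prob_measures X"
      using closedin_subset[OF \<A>(1)] by simp
    have "measure_topology X closure_of \<A> = topspace (measure_topology X)"
    proof (rule dense_in_measure_topologyI)
      fix \<mu> F and e :: real
      assume \<mu>: "\<mu> \<in> prob_measures X" and F: "finite F" "F \<subseteq> cont_funs X" and e: "0 < e"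
      obtain \<mu>0 T where \<mu>0: "\<mu>0 \<in> prob_measures X" "finite T" "T \<subseteq> topspace X" "emeasure \<mu>0 T = 1"
        "\<forall>\<mu>'\<in>prob_measures X. push_measure Y p \<mu>' = push_measure Y p \<mu>0 \<longrightarrow>
          (\<forall>f\<in>F. \<bar>integral\<^sup>L \<mu>' f - integral\<^sup>L \<mu> f\<bar> < e)"
        using fibre_approximation[OF X Y cp subset_refl fib \<mu> F e] .
      have "push_measure Y p \<mu>0 \<in> push_measure Y p ` \<A>"
        using \<A>(2) push_measure_in_prob_measures[OF Y cp \<mu>0(1)] by simp
      then obtain \<mu>' where "\<mu>' \<in> \<A>" "push_measure Y p \<mu>' = push_measure Y p \<mu>0"
        by force
      then show "\<exists>\<mu>'\<in>\<A> \<inter> prob_measures X. \<forall>f\<in>F. \<bar>integral\<^sup>L \<mu>' f - integral\<^sup>L \<mu> f\<bar> < e"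
        using \<mu>0(5) sub by blast
    qed
    then show ?thesis
      using closure_of_closedin[OF \<A>(1)] by simp
  qed
  then show ?thesis
    using continuous_surjection_push_measure[OF X Y p] by (simp add: irreducible_map_def)
qed

lemma almost_one_to_one_push_measure:
  assumes X: "compact_space X" "Hausdorff_space X" and Y: "Hausdorff_space Y"
    and aoo: "almost_one_to_one X Y p"
  shows "almost_one_to_one (measure_topology X) (measure_topology Y) (push_measure Y p)"
proof -
  have p: "continuous_surjection X Y p" using aoo by (simp add: almost_one_to_one_def)
  then have cp: "continuous_map X Y p" by (simp add: continuous_surjection_def)
  let ?S = "injectivity_points X p"
  have S: "?S \<subseteq> topspace X" by (auto simp: injectivity_points_def)
  have "\<exists>z\<in>?S. {x \<in> topspace X. p x = p z} \<subseteq> W" if W: "openin X W" "W \<noteq> {}" for W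
  proof -
    obtain z where "z \<in> ?S" "z \<in> W"
      using aoo W unfolding almost_one_to_one_def dense_intersects_open by blast
    then show ?thesis by (intro bexI[of _ z]) (auto simp: injectivity_points_def)
  qed
  then have fib: "\<forall>W. openin X W \<and> W \<noteq> {} \<longrightarrow> (\<exists>z\<in>?S. {x \<in> topspace X. p x = p z} \<subseteq> W)"
    by blast
  have "measure_topology X closure_of (injectivity_points (measure_topology X) (push_measure Y p))
      = topspace (measure_topology X)"
  proof (rule dense_in_measure_topologyI)
    fix \<mu> F and e :: real
    assume \<mu>: "\<mu> \<in> prob_measures X" and F: "finite F" "F \<subseteq> cont_funs X" and e: "0 < e"
    obtain \<mu>0 T where \<mu>0: "\<mu>0 \<in> prob_measures X" "finite T" "T \<subseteq> ?S" "emeasure \<mu>0 T = 1"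
      "\<forall>\<mu>'\<in>prob_measures X. push_measure Y p \<mu>' = push_measure Y p \<mu>0 \<longrightarrow>
        (\<forall>f\<in>F. \<bar>integral\<^sup>L \<mu>' f - integral\<^sup>L \<mu> f\<bar> < e)"
      using fibre_approximation[OF X Y cp S fib \<mu> F e] .
    have "\<mu>0 \<in> injectivity_points (measure_topology X) (push_measure Y p)"
      using eq_measure_on_injectivity_points[OF X(2) Y cp \<mu>0(2,3,1,4)] \<mu>0(1)
      by (auto simp: injectivity_points_def)
    then show "\<exists>\<mu>'\<in>injectivity_points (measure_topology X) (push_measure Y p) \<inter> prob_measures X.
        \<forall>f\<in>F. \<bar>integral\<^sup>L \<mu>' f - integral\<^sup>L \<mu> f\<bar> < e"
      using \<mu>0(1,5) by blast
  qed
  then show ?thesis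
    using continuous_surjection_push_measure[OF X Y p] by (simp add: almost_one_to_one_def)
qed

section \<open>The hyperspace map\<close>

text \<open>The preimage of a basic open set is the basic open set given by the preimages \<open>{x. p x \<in>
  U}\<close>, unless one of these is empty; then it is empty, too.\<close>

lemma continuous_map_hyperspace:
  assumes X: "compact_space X" and Y: "Hausdorff_space Y" and p: "continuous_map X Y p"
  shows "continuous_map (vietoris_topology X) (vietoris_topology Y) (\<lambda>A. p ` A)"
proof -
  have img: "p ` A \<in> hyperspace Y" if A: "A \<in> hyperspace X" for A
  proof -
    have "compactin Y (p ` A)"
      using A image_compactin[OF closedin_compact_space[OF X] p] by (simp add: hyperspace_def)
    then show ?thesis
      using A compactin_imp_closedin[OF Y] by (simp add: hyperspace_def)
  qed
  have basic: "openin (vietoris_topology X) {A \<in> hyperspace X. p ` A \<in> \<B>}" if B: "vietoris_basic Y \<B>" for \<B>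
  proof -
    obtain \<U> where U: "finite \<U>" "\<U> \<noteq> {}" "\<forall>U\<in>\<U>. openin Y U \<and> U \<noteq> {}"
      "\<B> = {A \<in> hyperspace Y. A \<subseteq> \<Union>\<U> \<and> (\<forall>U\<in>\<U>. A \<inter> U \<noteq> {})}"
      using B by (auto simp: vietoris_basic_def)
    let ?pre = "\<lambda>U. {x \<in> topspace X. p x \<in> U}"
    have top: "A \<subseteq> topspace X" if "A \<in> hyperspace X" for A
      using that closedin_subset by (auto simp: hyperspace_def)
    have eq: "{A \<in> hyperspace X. p ` A \<in> \<B>} =
        {A \<in> hyperspace X. A \<subseteq> \<Union>(?pre ` \<U>) \<and> (\<forall>V\<in>?pre ` \<U>. A \<inter> V \<noteq> {})}"
      unfolding U(4) using img top by (fastforce simp: image_subset_iff)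
    show ?thesis
    proof (cases "\<exists>U\<in>\<U>. ?pre U = {}")
      case True
      then have "{A \<in> hyperspace X. p ` A \<in> \<B>} = {}"
        unfolding eq by blast
      then show ?thesis by (simp only: openin_empty)
    next
      case False
      then have "vietoris_basic X {A \<in> hyperspace X. p ` A \<in> \<B>}"
        unfolding eq vietoris_basic_def using U(1-3) openin_continuous_map_preimage[OF p]
        by (intro exI[of _ "?pre ` \<U>"]) auto
      then show ?thesis
        by (simp add: openin_vietoris_topology arbitrary_union_of_inc)
    qed
  qed
  have "openin (vietoris_topology X) {A \<in> hyperspace X. p ` A \<in> \<W>}"
    if "openin (vietoris_topology Y) \<W>" for \<W>
  proof -
    obtain \<K> where K: "\<And>\<B>. \<B> \<in> \<K> \<Longrightarrow> vietoris_basic Y \<B>" "\<W> = \<Union>\<K>"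
      using \<open>openin (vietoris_topology Y) \<W>\<close>
      unfolding openin_vietoris_topology union_of_def by blast
    have "{A \<in> hyperspace X. p ` A \<in> \<W>} = (\<Union>\<B>\<in>\<K>. {A \<in> hyperspace X. p ` A \<in> \<B>})"
      using K(2) by auto
    then show ?thesis
      using basic[OF K(1)] by (auto intro!: openin_Union)
  qed
  then show ?thesis
    using img by (simp add: continuous_map_def)
qed

text \<open>A basic open set contains a finite set with one injectivity point of \<open>p\<close> in each of
  the given open sets, and a set of injectivity points is the only set with its image.\<close>

lemma almost_one_to_one_hyperspace:
  assumes X: "compact_space X" "Hausdorff_space X" and Y: "Hausdorff_space Y"
    and aoo: "almost_one_to_one X Y p"
  shows "almost_one_to_one (vietoris_topology X) (vietoris_topology Y) (\<lambda>A. p ` A)"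
proof -
  have p: "continuous_map X Y p" "p ` topspace X = topspace Y"
    using aoo by (auto simp: almost_one_to_one_def continuous_surjection_def)
  have cont: "continuous_map (vietoris_topology X) (vietoris_topology Y) (\<lambda>A. p ` A)"
    by (rule continuous_map_hyperspace[OF X(1) Y p(1)])
  have "hyperspace Y \<subseteq> (\<lambda>A. p ` A) ` hyperspace X"
  proof
    fix B assume B: "B \<in> hyperspace Y"
    let ?A = "{x \<in> topspace X. p x \<in> B}"
    have "B \<subseteq> p ` topspace X"
      using B p(2) closedin_subset[of Y B] by (auto simp: hyperspace_def)
    then have img: "p ` ?A = B" by auto
    moreover have "closedin X ?A"
      using B closedin_continuous_map_preimage[OF p(1)] by (simp add: hyperspace_def)
    ultimately have "?A \<in> hyperspace X"
      using B by (auto simp: hyperspace_def)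
    then show "B \<in> (\<lambda>A. p ` A) ` hyperspace X" using img by blast
  qed
  moreover have "(\<lambda>A. p ` A) ` hyperspace X \<subseteq> hyperspace Y"
    using continuous_map_image_subset_topspace[OF cont] by simp
  ultimately have surj: "continuous_surjection (vietoris_topology X) (vietoris_topology Y) (\<lambda>A. p ` A)"
    using cont by (auto simp: continuous_surjection_def)
  let ?I = "injectivity_points (vietoris_topology X) (\<lambda>A. p ` A)"
  have basic: "?I \<inter> \<B> \<noteq> {}" if B: "vietoris_basic X \<B>" for \<B>
  proof -
    obtain \<U> where U: "finite \<U>" "\<U> \<noteq> {}" "\<forall>U\<in>\<U>. openin X U \<and> U \<noteq> {}"
      "\<B> = {A \<in> hyperspace X. A \<subseteq> \<Union>\<U> \<and> (\<forall>U\<in>\<U>. A \<inter> U \<noteq> {})}"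
      using B by (auto simp: vietoris_basic_def)
    have "\<exists>q. q \<in> injectivity_points X p \<and> q \<in> U" if "U \<in> \<U>" for U
      using aoo U(3) that unfolding almost_one_to_one_def dense_intersects_open by blast
    then obtain q where q: "\<And>U. U \<in> \<U> \<Longrightarrow> q U \<in> injectivity_points X p" "\<And>U. U \<in> \<U> \<Longrightarrow> q U \<in> U"
      by metis
    let ?A = "q ` \<U>"
    have Ainj: "?A \<subseteq> injectivity_points X p" using q(1) by blast
    then have At: "?A \<subseteq> topspace X" by (auto simp: injectivity_points_def)
    have A: "?A \<in> hyperspace X"
      using U(1,2) closedin_Hausdorff_finite[OF X(2) At] by (simp add: hyperspace_def)
    then have "?A \<in> \<B>"
      unfolding U(4) using q(2) by auto
    moreover have "C = ?A" if C: "C \<in> hyperspace X" "p ` C = p ` ?A" for C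
    proof -
      have Ct: "C \<subseteq> topspace X" using C(1) closedin_subset by (auto simp: hyperspace_def)
      have inj: "x = a" if "x \<in> topspace X" "a \<in> ?A" "p x = p a" for x a
        using that Ainj by (auto simp: injectivity_points_def)
      show ?thesis
      proof (intro equalityI subsetI)
        fix x assume x: "x \<in> C"
        then have "p x \<in> p ` ?A" using C(2) by blast
        then obtain a where "a \<in> ?A" "p x = p a" by blast
        then show "x \<in> ?A" using inj[of x a] x Ct by blast
      next
        fix a assume a: "a \<in> ?A"
        then have "p a \<in> p ` C" using C(2) by blast
        then obtain x where "x \<in> C" "p x = p a" by force
        then show "a \<in> C" using inj[of x a] a Ct by blast
      qed
    qed
    then have "?A \<in> ?I"
      using A by (auto simp: injectivity_points_def)
    ultimately show ?thesis by blast
  qed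
  have "vietoris_topology X closure_of ?I = topspace (vietoris_topology X)"
    unfolding dense_intersects_open
  proof (intro allI impI)
    fix \<W> assume W: "openin (vietoris_topology X) \<W> \<and> \<W> \<noteq> {}"
    then obtain \<K> where K: "\<And>\<B>. \<B> \<in> \<K> \<Longrightarrow> vietoris_basic X \<B>" "\<W> = \<Union>\<K>"
      unfolding openin_vietoris_topology union_of_def by blast
    then show "?I \<inter> \<W> \<noteq> {}"
      using W basic by blast
  qed
  then show ?thesis
    using surj by (simp add: almost_one_to_one_def)
qed

section \<open>The theorem\<close>

theorem theorem1p2:
  fixes X :: "'a topology" and Y :: "'b topology" and \<pi> :: "'a \<Rightarrow> 'b"
  assumes "compact_space X" and "Hausdorff_space X"
    and "compact_space Y" and "Hausdorff_space Y"
    and "continuous_surjection X Y \<pi>"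
  shows "(irreducible_map (measure_topology X) (measure_topology Y) (push_measure Y \<pi>)
            \<longleftrightarrow> irreducible_map X Y \<pi>)
       \<and> (almost_one_to_one X Y \<pi>
            \<longrightarrow> almost_one_to_one (measure_topology X) (measure_topology Y) (push_measure Y \<pi>))
       \<and> (almost_one_to_one X Y \<pi>
            \<longrightarrow> almost_one_to_one (vietoris_topology X) (vietoris_topology Y) (\<lambda>A. \<pi> ` A))
       \<and> (metrizable_space X \<and> metrizable_space Y
            \<longrightarrow> (almost_one_to_one (measure_topology X) (measure_topology Y) (push_measure Y \<pi>)
                   \<longleftrightarrow> almost_one_to_one X Y \<pi>))"
proof -
  have irr: "irreducible_map (measure_topology X) (measure_topology Y) (push_measure Y \<pi>)
      \<longleftrightarrow> irreducible_map X Y \<pi>"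
    using irreducible_push_measure irreducible_push_measure_imp assms by metis
  moreover have "almost_one_to_one X Y \<pi>
      \<longrightarrow> almost_one_to_one (measure_topology X) (measure_topology Y) (push_measure Y \<pi>)"
    using almost_one_to_one_push_measure[OF assms(1,2,4)] by blast
  moreover have "almost_one_to_one X Y \<pi>
      \<longrightarrow> almost_one_to_one (vietoris_topology X) (vietoris_topology Y) (\<lambda>A. \<pi> ` A)"
    using almost_one_to_one_hyperspace[OF assms(1,2,4)] by blast
  moreover have "almost_one_to_one X Y \<pi>"
    if "metrizable_space X" "almost_one_to_one (measure_topology X) (measure_topology Y) (push_measure Y \<pi>)"
    using irr almost_one_to_one_imp_irreducible[OF that(2)]
      irreducible_metrizable_imp_almost_one_to_one[OF assms(1,2) that(1) assms(4)] by blast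
  ultimately show ?thesis by blast
qed

end
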